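(* Fix $F\in\mathcal S^\sharp$ together with its $\gamma$. Let $C>0$. Let $t<0$ with $|t|\le C$, and let $s=x+iy$ with $x\in\mathbb R$, $y>0$ and $|x|\le Cy^{1/4}$. Then there exist $y_0>0$ and $K>0$, depending only on $C$, $F$ and $\gamma$, such that for all such $t,s$ with $y\ge y_0$, \[ \xi^F_t(J_t(s))=\gamma_t(s)\Bigl(F_t(s)+E\Bigr),\qquad |E|\le K\,y^{-1/5}\exp\!\Bigl(\tfrac{10}{|t|}\min(x,-2)^2\Bigr). \]
   Context: $\operatorname{Log}$ denotes the principal branch of the logarithm ($\operatorname{Log} z=\log|z|+i\operatorname{Arg} z$ with $\operatorname{Arg} z\in(-\pi,\pi]$). The extended Selberg class $\mathcal S^\sharp$ is the set of functions $F$, not identically zero, such that: (i) $F(s)=\sum_{n\ge1}a_n n^{-s}$, with the series converging absolutely for $\Re s>1$; (ii) $(s-1)^mF(s)$ extends to an entire function of finite order for some integer $m\ge0$; (iii) letting $m$ be the order of the pole of $F$ at $s=1$ ($m=0$ if there is no pole), there is a function $\gamma(s)=\alpha s^m(s-1)^mQ^s\prod_{i=1}^k\Gamma(\omega_i s+\mu_i)$ with $\alpha\in\mathbb C\setminus\{0\}$, $Q>0$, an integer $k\ge1$, $\omega_i>0$ and $\mu_i\in\mathbb C$ with $\Re\mu_i\ge0$, such that the (entire) function $\xi^F(s):=\gamma(s)F(s)$ satisfies $\xi^F(s)=\overline{\xi^F(1-\bar s)}$ for all $s$. Define $\Phi_F(u):=\frac{1}{2\pi}\int_{-\infty}^{\infty}\xi^F\!\left(\frac{1+ix}{2}\right)e^{-ixu}\,dx$,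 and $\xi^F_t\!\left(\frac{1+iz}{2}\right):=\int_{-\infty}^{\infty}e^{tu^2}\Phi_F(u)e^{izu}\,du$ (an entire function). For $t<0$: $F_t(s):=\sum_{n\ge1}\exp\!\left(-\frac{|t|}{4}\log^2 n\right)a_n n^{-s}$ (absolutely convergent for all $s$); for $\Im s>0$, $J_t(s):=s+\frac{|t|}{2}\log Q+\frac{|t|}{2}\sum_{i=1}^k\omega_i\operatorname{Log}(\omega_i s)$ and $\gamma_t(s):=\gamma(s)\exp\!\left(\frac{1}{|t|}(s-J_t(s))^2\right)$. *)

theory Defs
  imports "HOL-Analysis.Analysis"
begin

definition gamma_fac ::
  "nat \<Rightarrow> complex \<Rightarrow> real \<Rightarrow> nat \<Rightarrow> (nat \<Rightarrow> real) \<Rightarrow> (nat \<Rightarrow> complex) \<Rightarrow> complex \<Rightarrow> complex" where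
  "gamma_fac m \<alpha> Q k \<omega> \<mu> s =
     \<alpha> * s ^ m * (s - 1) ^ m * (of_real Q powr s) *
     (\<Prod>i<k. Gamma (of_real (\<omega> i) * s + \<mu> i))"

text \<open>Membership of F in the extended Selberg class, with coefficients a (a 0 unused),
  pole order m, gamma-factor data (alpha, Q, k, omega, mu), and xi the entire function
  gamma*F (the entire extension, agreeing with gamma*F away from s = 1 and from the
  poles of the Gamma factors).\<close>
definition selberg_sharp ::
  "(nat \<Rightarrow> complex) \<Rightarrow> (complex \<Rightarrow> complex) \<Rightarrow> nat \<Rightarrow> complex \<Rightarrow> real \<Rightarrow> nat \<Rightarrow>
   (nat \<Rightarrow> real) \<Rightarrow> (nat \<Rightarrow> complex) \<Rightarrow> (complex \<Rightarrow> complex) \<Rightarrow> bool" where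
  "selberg_sharp a F m \<alpha> Q k \<omega> \<mu> xi \<longleftrightarrow>
     (\<exists>s. s \<noteq> 1 \<and> F s \<noteq> 0) \<and>
     (\<forall>s. 1 < Re s \<longrightarrow>
        summable (\<lambda>n. norm (a (Suc n) / of_nat (Suc n) powr s)) \<and>
        F s = (\<Sum>n. a (Suc n) / of_nat (Suc n) powr s)) \<and>
     (\<exists>G. G holomorphic_on UNIV \<and>
        (\<exists>\<rho> A. \<forall>z. norm (G z) \<le> A * exp (norm z powr \<rho>)) \<and>
        (\<forall>s. s \<noteq> 1 \<longrightarrow> G s = (s - 1) ^ m * F s) \<and>
        (0 < m \<longrightarrow> G 1 \<noteq> 0)) \<and>
     \<alpha> \<noteq> 0 \<and> 0 < Q \<and> 1 \<le> k \<and>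
     (\<forall>i<k. 0 < \<omega> i \<and> 0 \<le> Re (\<mu> i)) \<and>
     xi holomorphic_on UNIV \<and>
     (\<forall>s. s \<noteq> 1 \<and> (\<forall>i<k. of_real (\<omega> i) * s + \<mu> i \<notin> \<int>\<^sub>\<le>\<^sub>0) \<longrightarrow>
        xi s = gamma_fac m \<alpha> Q k \<omega> \<mu> s * F s) \<and>
     (\<forall>s. xi s = cnj (xi (1 - cnj s)))"

definition Phi_F :: "(complex \<Rightarrow> complex) \<Rightarrow> real \<Rightarrow> complex" where
  "Phi_F xi u = (1 / (2 * pi)) *
     (LINT x|lborel. xi ((1 + \<i> * of_real x) / 2) * exp (- \<i> * of_real x * of_real u))"

text \<open>xi_t(w) where w = (1+iz)/2, i.e. z = -i(2w-1):
  xi_t((1+iz)/2) = int e^{tu^2} Phi_F(u) e^{izu} du\<close>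
definition xi_t :: "(complex \<Rightarrow> complex) \<Rightarrow> real \<Rightarrow> complex \<Rightarrow> complex" where
  "xi_t xi t w = (let z = - \<i> * (2 * w - 1) in
     LINT u|lborel. of_real (exp (t * u\<^sup>2)) * Phi_F xi u * exp (\<i> * z * of_real u))"

definition F_t :: "(nat \<Rightarrow> complex) \<Rightarrow> real \<Rightarrow> complex \<Rightarrow> complex" where
  "F_t a t s = (\<Sum>n. of_real (exp (- (\<bar>t\<bar> / 4) * (ln (real (Suc n)))\<^sup>2)) * a (Suc n)
                      / of_nat (Suc n) powr s)"

definition J_t :: "real \<Rightarrow> nat \<Rightarrow> (nat \<Rightarrow> real) \<Rightarrow> real \<Rightarrow> complex \<Rightarrow> complex" where
  "J_t Q k \<omega> t s = s + of_real (\<bar>t\<bar> / 2 * ln Q) +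
     of_real (\<bar>t\<bar> / 2) * (\<Sum>i<k. of_real (\<omega> i) * Ln (of_real (\<omega> i) * s))"

definition gamma_t ::
  "nat \<Rightarrow> complex \<Rightarrow> real \<Rightarrow> nat \<Rightarrow> (nat \<Rightarrow> real) \<Rightarrow> (nat \<Rightarrow> complex) \<Rightarrow> real \<Rightarrow> complex \<Rightarrow> complex" where
  "gamma_t m \<alpha> Q k \<omega> \<mu> t s =
     gamma_fac m \<alpha> Q k \<omega> \<mu> s * exp ((1 / of_real \<bar>t\<bar>) * (s - J_t Q k \<omega> t s)\<^sup>2)"

end

theory Submission
  imports Defs "HOL-Complex_Analysis.Complex_Analysis" "HOL-Probability.Sinc_Integral"
    "HOL-Probability.Characteristic_Functions" "HOL-Real_Asymp.Real_Asymp"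
begin

text \<open>
  For \<open>t < 0\<close>, Fubini and the Gaussian Fourier transform turn \<open>xi_t\<close> into the convolution
  \<open>1 / sqrt (pi * \<bar>t\<bar>) * \<integral> xi (1/2 + \<i> * v) * exp ((w - 1/2 - \<i> * v)\<^sup>2 / \<bar>t\<bar>) dv\<close>; the integrability of \<open>xi\<close>
  comes from a Phragmen-Lindelof argument. Shift the line of integration to real part
  \<open>c = max (Re s) 2\<close>, where \<open>xi = \<gamma> * F\<close> with \<open>F\<close> given by its Dirichlet series, and put \<open>w = J_t s\<close>.
  Since \<open>2 * (J_t s - s) / \<bar>t\<bar>\<close> is \<open>\<Lambda> s\<close>, the approximate logarithmic derivative of \<open>\<gamma>\<close> at \<open>s\<close>,
  expanding the square shows that the integrand at \<open>s + h\<close> is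
  \<open>\<gamma>_t s * R h * F (s + h) * exp (h\<^sup>2 / \<bar>t\<bar>)\<close> with \<open>R h = \<gamma> (s + h) / \<gamma> s * exp (- \<Lambda> s * h)\<close>.
  Replacing \<open>R h\<close> by 1 gives exactly \<open>F_t s\<close>, term by term. As \<open>Digamma z = Ln z + O(1 / norm z)\<close>,
  \<open>norm (R h - 1) \<le> exp (K * (1 + (norm h)\<^sup>2) / sqrt (Im s)) - 1\<close> on the whole line, which the Gaussian absorbs.
\<close>

section \<open>The Gamma function on vertical lines and in sectors\<close>

text \<open>The bound on \<open>R h\<close> is needed at every height of the line, including where
  it crosses the real axis and continues far below it. There \<open>Ln (w * s)\<close> no longer
  approximates \<open>Digamma\<close> along the path, and only an error of size
  \<open>norm h powr (3/2)\<close> is available; but \<open>norm h\<close> is at least Im s / 2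
  there, so this is still (norm h)^2 times O(1 / sqrt (Im s)). Hence the rate y^(-1/2), which lies
  inside the claimed y^(-1/5). The factor exp (10 min(x,-2)^2 / |t|) pays for moving right by d =
  max x 2 - x: the Gaussian grows by exp (d^2 / |t|), and absorbing \<open>R h - 1\<close> spends
  half of its exponent, which costs another exp (d^2 / (2|t|)). The condition |t| <= C keeps the
  Gaussian steep enough to do this uniformly in t. For the decay of \<open>xi\<close>, finite order
  supplies only a crude a priori bound in strips. The actual decay comes from one Gamma factor on
  the right edge and from the functional equation on the left edge.\<close>

lemma le_one_plus_square: "(x :: real) \<le> 1 + x\<^sup>2"
proof -
  have "0 \<le> (x - 1 / 2)\<^sup>2" by simp
  then show ?thesis by (simp add: power2_eq_square algebra_simps)
qed

lemma sqrt_le_self: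
  assumes "1 \<le> (y :: real)"
  shows "sqrt y \<le> y"
proof -
  have "sqrt y * 1 \<le> sqrt y * sqrt y" using assms by (intro mult_left_mono) auto
  then show ?thesis using assms by simp
qed

section \<open>Bounds for Gamma in the right half-plane\<close>

lemma not_nonpos_Ints_Re_pos: "0 < Re z \<Longrightarrow> z \<notin> \<int>\<^sub>\<le>\<^sub>0"
  by (auto elim!: nonpos_Ints_cases)

text \<open>In Euler's limit the numerators have equal norm, and each factor z + j of the
  denominator has norm at least Re z + j. The inequality passes to the limit.\<close>

lemma norm_Gamma_le_Gamma_Re:
  assumes "0 < Re z"
  shows "norm (Gamma z) \<le> Gamma (Re z)"
proof (rule LIMSEQ_le[OF tendsto_norm[OF Gamma_series_LIMSEQ] Gamma_series_LIMSEQ], intro exI allI impI)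
  fix n :: nat
  have poch: "pochhammer (Re z) (n + 1) \<le> norm (pochhammer z (n + 1))"
    unfolding pochhammer_prod prod_norm [symmetric]
    using assms by (intro prod_mono) (auto intro: order_trans[OF _ complex_Re_le_cmod])
  moreover have "0 < pochhammer (Re z) (n + 1)"
    using assms by (intro pochhammer_pos)
  ultimately show "norm (Gamma_series z n) \<le> Gamma_series (Re z) n"
    by (auto simp: Gamma_series_def norm_divide norm_mult intro!: frac_le)
qed

text \<open>Gamma (z + N) is Gamma z times the factors z, ..., z + N - 1, each of norm at least norm
  z. This gives decay of any polynomial order on vertical lines, without Stirling's formula.\<close>

lemma norm_Gamma_decay:
  assumes "0 < Re z"
  shows "norm (Gamma z) * norm z ^ N \<le> Gamma (Re z + real N)"
  using assms
proof (induction N arbitrary: z)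
  case 0
  then show ?case by (simp add: norm_Gamma_le_Gamma_Re)
next
  case (Suc N)
  have "norm z \<le> norm (z + 1)"
    using Suc.prems by (simp add: cmod_def power2_eq_square algebra_simps)
  then have "norm (Gamma (z + 1)) * norm z ^ N \<le> norm (Gamma (z + 1)) * norm (z + 1) ^ N"
    by (intro mult_left_mono power_mono) auto
  also have "\<dots> \<le> Gamma (Re z + real (Suc N))"
    using Suc.IH[of "z + 1"] Suc.prems by (simp add: add_ac)
  finally show ?case
    using Gamma_plus1[OF not_nonpos_Ints_Re_pos[OF Suc.prems]] by (simp add: norm_mult mult_ac)
qed

text \<open>The condition \<open>- norm z / 2 \<le> Re z\<close> describes the sector \<open>\<bar>Arg z\<bar> \<le> 2 * pi / 3\<close>.\<close>
lemma sector_add: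
  assumes "- norm z / 2 \<le> Re z" "0 \<le> u"
  shows "(norm z + u) / 2 \<le> norm (z + of_real u)" and "- norm (z + of_real u) / 2 \<le> Re (z + of_real u)"
proof -
  have "((norm z + u) / 2)\<^sup>2 \<le> (norm z)\<^sup>2 + u\<^sup>2 - norm z * u"
    using zero_le_power2[of "norm z - u"] by (simp add: power2_eq_square field_simps)
  also have "\<dots> \<le> (norm z)\<^sup>2 + u\<^sup>2 + 2 * Re z * u"
    using mult_right_mono[OF assms] by simp
  also have "\<dots> = (norm (z + of_real u))\<^sup>2"
    unfolding cmod_power2 by (simp add: power2_eq_square algebra_simps)
  finally show "(norm z + u) / 2 \<le> norm (z + of_real u)"
    by (rule power2_le_imp_le) simp
  have "norm z \<le> norm (z + of_real u) + u"
    using norm_triangle_ineq4[of "z + of_real u" "of_real u"] assms(2) by simp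
  then show "- norm (z + of_real u) / 2 \<le> Re (z + of_real u)"
    using assms by simp
qed

section \<open>Digamma compared with the logarithm in the sector\<close>

lemma sector_not_nonpos_Reals:
  assumes "- norm z / 2 \<le> Re z" "z \<noteq> 0"
  shows "z \<notin> \<real>\<^sub>\<le>\<^sub>0"
  using assms by (auto elim!: nonpos_Reals_cases simp: complex_eq_iff)

text \<open>The left side is the integral of 1/w - 1/z over the segment from z to z + 1. There |w -
  z| <= 1, and \<open>sector_add\<close> gives norm w >= norm z / 2.\<close>

lemma norm_Ln_plus1_diff_le:
  assumes "- norm z / 2 \<le> Re z" "z \<noteq> 0"
  shows "norm (Ln (z + 1) - Ln z - inverse z) \<le> 2 / (norm z)\<^sup>2"
proof -
  define f where "f = (\<lambda>w. Ln w - w / z)"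
  have seg: "norm (1 / w - 1 / z) \<le> 2 / (norm z)\<^sup>2 \<and> w \<notin> \<real>\<^sub>\<le>\<^sub>0"
    if w: "w \<in> closed_segment z (z + 1)" for w
  proof -
    obtain u where u: "0 \<le> u" "u \<le> 1" "w = z + of_real u"
      using w unfolding closed_segment_def by (auto simp: algebra_simps scaleR_conv_of_real)
    have low: "norm z / 2 \<le> norm w" and w0: "w \<noteq> 0" and "w \<notin> \<real>\<^sub>\<le>\<^sub>0"
    proof -
      show "norm z / 2 \<le> norm w" using sector_add(1)[OF assms(1) u(1)] u by simp
      then show "w \<noteq> 0" using assms(2) by auto
      then show "w \<notin> \<real>\<^sub>\<le>\<^sub>0" using sector_add(2)[OF assms(1) u(1)] u sector_not_nonpos_Reals by blast
    qed
    have "1 / w - 1 / z = - of_real u / (w * z)"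
      using w0 assms(2) by (simp add: u field_simps)
    then have "norm (1 / w - 1 / z) = u / (norm w * norm z)"
      using u by (simp add: norm_divide norm_mult)
    also have "\<dots> \<le> 1 / (norm z / 2 * norm z)"
      using low u assms(2) by (intro frac_le mult_right_mono) auto
    finally show ?thesis using \<open>w \<notin> \<real>\<^sub>\<le>\<^sub>0\<close> by (simp add: power2_eq_square)
  qed
  have "norm (f (z + 1) - f z) \<le> 2 / (norm z)\<^sup>2 * norm (z + 1 - z)"
  proof (rule field_differentiable_bound[of "closed_segment z (z + 1)" f "\<lambda>w. 1 / w - 1 / z"])
    fix w assume w: "w \<in> closed_segment z (z + 1)"
    show "(f has_field_derivative 1 / w - 1 / z) (at w within closed_segment z (z + 1))"
      unfolding f_def using seg[OF w] by (auto intro!: derivative_eq_intros simp: field_simps)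
    show "norm (1 / w - 1 / z) \<le> 2 / (norm z)\<^sup>2" using seg[OF w] by simp
  qed auto
  moreover have "f (z + 1) - f z = Ln (z + 1) - Ln z - inverse z"
    using assms(2) by (simp add: f_def field_simps)
  ultimately show ?thesis by simp
qed

lemma sum_inverse_squares_le:
  assumes "0 < (r::real)"
  shows "(\<Sum>n<m. 1 / (r + real n)\<^sup>2) \<le> 1 / r\<^sup>2 + 1 / r"
proof -
  \<comment> \<open>Subtracting the telescoping remainder makes the claim inductive; summing to
    \<open>Suc m\<close> makes the base case an equality.\<close>
  have "(\<Sum>n<Suc m. 1 / (r + real n)\<^sup>2) \<le> 1 / r\<^sup>2 + 1 / r - 1 / (r + real m)"
  proof (induction m)
    case (Suc m)
    define q where "q = r + real m"
    have q: "0 < q" using assms by (simp add: q_def)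
    have "1 / (q + 1)\<^sup>2 \<le> 1 / (q * (q + 1))"
      using q by (intro divide_left_mono) (auto simp: power2_eq_square)
    also have "\<dots> = 1 / q - 1 / (q + 1)"
      using q by (simp add: field_simps)
    finally show ?case
      using Suc.IH by (simp add: q_def add_ac)
  qed simp
  moreover have "0 \<le> 1 / (r + real m)" and "0 \<le> 1 / (r + real m)\<^sup>2"
    using assms by auto
  ultimately show ?thesis unfolding sum.lessThan_Suc by linarith
qed

text \<open>Digamma z - Ln z is the infinite sum of Ln (z + n + 1) - Ln (z + n) - 1 / (z + n). By
  \<open>sector_add\<close> the n-th term is at most 8 / (norm z + n)^2, so the sum is bounded
  uniformly in the sector.\<close>

lemma norm_Digamma_minus_Ln_le:
  assumes "- norm z / 2 \<le> Re z" "z \<noteq> 0"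
  shows "norm (Digamma z - Ln z) \<le> 8 * (1 / norm z + 1 / (norm z)\<^sup>2)"
proof (rule Lim_bounded)
  have zn: "z + of_nat n \<notin> \<real>\<^sub>\<le>\<^sub>0" "- norm (z + of_nat n) / 2 \<le> Re (z + of_nat n)"
           "(norm z + real n) / 2 \<le> norm (z + of_nat n)" "z + of_nat n \<noteq> 0" for n
  proof -
    show 1: "- norm (z + of_nat n) / 2 \<le> Re (z + of_nat n)"
      and 2: "(norm z + real n) / 2 \<le> norm (z + of_nat n)"
      using sector_add[OF assms(1), of "real n"] by simp_all
    show "z + of_nat n \<noteq> 0" using 2 assms(2)
      by (metis add_pos_nonneg divide_pos_pos norm_zero not_le of_nat_0_le_iff zero_less_norm_iff zero_less_numeral)
    then show "z + of_nat n \<notin> \<real>\<^sub>\<le>\<^sub>0" using 1 sector_not_nonpos_Reals by blast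
  qed
  define T where "T = (\<lambda>m. (\<Sum>n<m. Ln (z + of_nat n + 1) - Ln (z + of_nat n) - inverse (z + of_nat n)))"
  \<comment> \<open>Inserting ln m separates the limit defining \<open>Digamma\<close> from a term
    that tends to 0.\<close>
  have T: "T m = of_real (ln (real m)) - (\<Sum>n<m. inverse (z + of_nat n)) + (Ln (z + of_nat m) - of_real (ln (real m))) - Ln z" for m
    unfolding T_def by (induction m) (auto simp: algebra_simps)
  have "(\<lambda>m. Ln (1 + z / of_nat m)) \<longlonglongrightarrow> Ln (1 + 0)"
    by (intro tendsto_intros lim_const_over_n) auto
  moreover have "\<forall>\<^sub>F m in sequentially. Ln (1 + z / of_nat m) = Ln (z + of_nat m) - of_real (ln (real m))"
    using eventually_gt_at_top[of 0]
  proof eventually_elim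
    case (elim m)
    have "z + of_nat m = of_real (real m) * (1 + z / of_nat m)"
      using elim by (simp add: field_simps)
    moreover have "1 + z / of_nat m \<noteq> 0" using calculation zn(4)[of m] by auto
    ultimately have "Ln (z + of_nat m) = of_real (ln (real m)) + Ln (1 + z / of_nat m)"
      using Ln_times_of_real[of "real m" "1 + z / of_nat m"] elim by simp
    then show ?case by simp
  qed
  ultimately have "(\<lambda>m. Ln (z + of_nat m) - of_real (ln (real m))) \<longlonglongrightarrow> 0"
    by (simp add: tendsto_cong)
  moreover have "(\<lambda>m. of_real (ln (real m)) - (\<Sum>n<m. inverse (z + of_nat n))) \<longlonglongrightarrow> Digamma z"
    by (rule Digamma_LIMSEQ[OF assms(2)])
  ultimately have "T \<longlonglongrightarrow> Digamma z + 0 - Ln z"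
    unfolding T by (intro tendsto_intros)
  then show "(\<lambda>m. norm (T m)) \<longlonglongrightarrow> norm (Digamma z - Ln z)"
    by (intro tendsto_norm) simp
  show "\<forall>m\<ge>0. norm (T m) \<le> 8 * (1 / norm z + 1 / (norm z)\<^sup>2)"
  proof (intro allI impI)
    fix m
    have "norm (T m) \<le> (\<Sum>n<m. 8 * (1 / (norm z + real n)\<^sup>2))"
      unfolding T_def
    proof (rule sum_norm_le)
      fix n
      have "norm (Ln (z + of_nat n + 1) - Ln (z + of_nat n) - inverse (z + of_nat n)) \<le> 2 / (norm (z + of_nat n))\<^sup>2"
        by (rule norm_Ln_plus1_diff_le[OF zn(2,4)])
      also have "\<dots> \<le> 2 / ((norm z + real n) / 2)\<^sup>2"
        using zn(3)[of n] assms(2) by (intro divide_left_mono power_mono mult_pos_pos zero_less_power)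
          (auto simp: zn(4) add_pos_nonneg)
      finally show "norm (Ln (z + of_nat n + 1) - Ln (z + of_nat n) - inverse (z + of_nat n)) \<le> 8 * (1 / (norm z + real n)\<^sup>2)"
        by (simp add: power_divide)
    qed
    also have "\<dots> \<le> 8 * (1 / norm z + 1 / (norm z)\<^sup>2)"
      unfolding sum_distrib_left [symmetric]
      using sum_inverse_squares_le[of "norm z" m] assms(2) by (intro mult_left_mono) auto
    finally show "norm (T m) \<le> 8 * (1 / norm z + 1 / (norm z)\<^sup>2)" .
  qed
qed

text \<open>Mean value inequality for ln_Gamma \<zeta> - \<zeta> l, whose derivative is Digamma
  \<zeta> - l. Both applications take l = Ln (w s), frozen at the base point.\<close>

lemma ln_Gamma_diff_bound:
  fixes z w l :: complex
  assumes S: "convex S" "z \<in> S" "w \<in> S"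
    and sec: "\<And>\<zeta>. \<zeta> \<in> S \<Longrightarrow> \<zeta> \<notin> \<real>\<^sub>\<le>\<^sub>0"
    and B: "\<And>\<zeta>. \<zeta> \<in> S \<Longrightarrow> norm (Digamma \<zeta> - l) \<le> B"
  shows "norm (ln_Gamma w - ln_Gamma z - (w - z) * l) \<le> B * norm (w - z)"
proof -
  have "norm ((\<lambda>\<zeta>. ln_Gamma \<zeta> - \<zeta> * l) w - (\<lambda>\<zeta>. ln_Gamma \<zeta> - \<zeta> * l) z) \<le> B * norm (w - z)"
  proof (rule field_differentiable_bound[OF S(1) _ B S(3,2)])
    fix \<zeta> assume "\<zeta> \<in> S"
    then have "((\<lambda>\<zeta>. ln_Gamma \<zeta> - \<zeta> * l) has_field_derivative Digamma \<zeta> - l) (at \<zeta>)"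
      using sec by (auto intro!: derivative_eq_intros)
    then show "((\<lambda>\<zeta>. ln_Gamma \<zeta> - \<zeta> * l) has_field_derivative Digamma \<zeta> - l) (at \<zeta> within S)"
      by (rule has_field_derivative_at_within)
  qed
  then show ?thesis by (simp add: algebra_simps)
qed

text \<open>While Im h >= - y / 2, the path stays at height at least w y / 4. Both Digamma - Ln and
  the variation of Ln along the path then carry a factor 1 / y.\<close>

lemma ln_Gamma_shift_near:
  fixes w :: real and \<mu> s h :: complex
  defines "y \<equiv> Im s"
  assumes w: "0 < w" and mu: "0 \<le> Re \<mu>" and y: "4 * norm \<mu> \<le> w * y" "4 \<le> w * y"
    and s: "- y / 8 \<le> Re s" and h: "0 \<le> Re h" "- y / 2 \<le> Im h"
  shows "norm (ln_Gamma (w * (s + h) + \<mu>) - ln_Gamma (w * s + \<mu>) - w * h * Ln (w * s))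
           \<le> (64 + 4 * norm \<mu> + 4 * w) * (1 + (norm h)\<^sup>2) / y"
proof -
  have "0 < w * y" using y(2) by linarith
  then have y0: "0 < y" using w by (simp add: zero_less_mult_iff)
  \<comment> \<open>The height w y / 4 is w (y + Im h) >= w y / 2 less |Im \<mu>| <= w y / 4. The
    bound - w y / 8 on the real part is minus half that height, which places \<open>S\<close> in the
    sector.\<close>
  define S where "S = {\<zeta>. w * y / 4 \<le> Im \<zeta>} \<inter> {\<zeta>. - (w * y / 8) \<le> Re \<zeta>}"
  have S: "convex S"
    unfolding S_def by (intro convex_Int convex_halfspace_Im_ge convex_halfspace_Re_ge)
  have mu': "\<bar>Im \<mu>\<bar> \<le> w * y / 4" using y(1) abs_Im_le_cmod[of \<mu>] by linarith
  have Rs: "- (w * y / 8) \<le> w * Re s" using mult_left_mono[OF s, of w] w by simp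
  have Rh: "0 \<le> w * Re h" using w h by simp
  have Ih: "- (w * y / 2) \<le> w * Im h" using mult_left_mono[OF h(2), of w] w by simp
  have zS: "w * s + \<mu> \<in> S" and zhS: "w * (s + h) + \<mu> \<in> S" and wsS: "w * s \<in> S"
    using mu mu' Rs Rh Ih y unfolding S_def y_def by (auto simp: algebra_simps)
  have SD: "w * y / 4 \<le> norm \<zeta>" "1 \<le> norm \<zeta>" "- norm \<zeta> / 2 \<le> Re \<zeta>" "\<zeta> \<noteq> 0" "\<zeta> \<notin> \<real>\<^sub>\<le>\<^sub>0" if "\<zeta> \<in> S" for \<zeta>
  proof -
    have i: "w * y / 4 \<le> Im \<zeta>" "- (w * y / 8) \<le> Re \<zeta>" using that by (auto simp: S_def)
    then show 1: "w * y / 4 \<le> norm \<zeta>" using abs_Im_le_cmod[of \<zeta>] by linarith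
    then show "1 \<le> norm \<zeta>" using y(2) by linarith
    then show "\<zeta> \<noteq> 0" by auto
    show "- norm \<zeta> / 2 \<le> Re \<zeta>" using 1 i by linarith
    then show "\<zeta> \<notin> \<real>\<^sub>\<le>\<^sub>0" using \<open>\<zeta> \<noteq> 0\<close> by (rule sector_not_nonpos_Reals)
  qed
  have Ln_lip: "norm (Ln \<zeta> - Ln (w * s)) \<le> 4 / (w * y) * norm (\<zeta> - w * s)" if "\<zeta> \<in> S" for \<zeta>
  proof (rule field_differentiable_bound[OF S, of Ln "\<lambda>\<zeta>. 1 / \<zeta>"])
    fix \<eta> assume eta: "\<eta> \<in> S"
    show "(Ln has_field_derivative 1 / \<eta>) (at \<eta> within S)"
      using SD(5)[OF eta] by (auto intro!: derivative_eq_intros simp: divide_inverse)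
    have "1 / norm \<eta> \<le> 1 / (w * y / 4)"
      using SD(1,4)[OF eta] w y0 by (intro divide_left_mono) auto
    then show "norm (1 / \<eta>) \<le> 4 / (w * y)" by (simp add: norm_divide)
  qed (use that wsS in auto)
  \<comment> \<open>The ball limits the distance to w s by w norm h + norm \<mu>, so the Lipschitz
    bound for \<open>Ln\<close> becomes a constant on \<open>T\<close>.\<close>
  define T where "T = S \<inter> cball (w * s + \<mu>) (w * norm h)"
  have "norm (ln_Gamma (w * (s + h) + \<mu>) - ln_Gamma (w * s + \<mu>) - (w * (s + h) + \<mu> - (w * s + \<mu>)) * Ln (w * s))
     \<le> ((64 + 4 * (w * norm h + norm \<mu>)) / (w * y)) * norm (w * (s + h) + \<mu> - (w * s + \<mu>))"
  proof (rule ln_Gamma_diff_bound)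
    show "convex T" unfolding T_def by (intro convex_Int S convex_cball)
    show "w * s + \<mu> \<in> T" "w * (s + h) + \<mu> \<in> T"
      unfolding T_def using zS zhS w by (auto simp: dist_norm norm_mult algebra_simps)
  next
    fix \<zeta> assume z: "\<zeta> \<in> T"
    then have zS: "\<zeta> \<in> S" by (simp add: T_def)
    show "\<zeta> \<notin> \<real>\<^sub>\<le>\<^sub>0" by (rule SD(5)[OF zS])
    have "1 / norm \<zeta> \<le> 1 / (w * y / 4)"
      using SD(1,4)[OF zS] w y0 by (intro divide_left_mono) auto
    moreover have "1 / (norm \<zeta>)\<^sup>2 \<le> 1 / norm \<zeta>"
      using SD(2)[OF zS] power_increasing[of 1 2 "norm \<zeta>"] by (intro divide_left_mono mult_pos_pos) auto
    \<comment> \<open>On \<open>S\<close> both reciprocals are at most 4 / (w y), and 64 = 8 * (4 +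
      4).\<close>
    ultimately have 1: "norm (Digamma \<zeta> - Ln \<zeta>) \<le> 64 / (w * y)"
      using norm_Digamma_minus_Ln_le[OF SD(3,4)[OF zS]] by simp
    have "norm (\<zeta> - w * s) \<le> w * norm h + norm \<mu>"
      using z norm_triangle_ineq[of "\<zeta> - (w * s + \<mu>)" \<mu>]
      by (simp add: T_def dist_norm norm_minus_commute)
    then have "4 / (w * y) * norm (\<zeta> - w * s) \<le> 4 / (w * y) * (w * norm h + norm \<mu>)"
      using w y0 by (intro mult_left_mono) auto
    then have 2: "norm (Ln \<zeta> - Ln (w * s)) \<le> 4 / (w * y) * (w * norm h + norm \<mu>)"
      using Ln_lip[OF zS] by linarith
    show "norm (Digamma \<zeta> - Ln (w * s)) \<le> (64 + 4 * (w * norm h + norm \<mu>)) / (w * y)"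
      using norm_triangle_le[OF add_mono[OF 1 2]] by (simp add: add_divide_distrib)
  qed
  also have "(w * (s + h) + \<mu> - (w * s + \<mu>)) = w * h" by (simp add: algebra_simps)
  also have "(64 + 4 * (w * norm h + norm \<mu>)) / (w * y) * norm (w * h) = (64 + 4 * norm \<mu>) / y * norm h + 4 * w / y * (norm h)\<^sup>2"
    using w y0 by (simp add: norm_mult field_simps power2_eq_square)
  also have "\<dots> \<le> (64 + 4 * norm \<mu>) / y * (1 + (norm h)\<^sup>2) + 4 * w / y * (1 + (norm h)\<^sup>2)"
  proof (intro add_mono mult_left_mono)
    show "norm h \<le> 1 + (norm h)\<^sup>2" by (rule le_one_plus_square)
  qed (use w y0 in auto)
  also have "\<dots> = (64 + 4 * norm \<mu> + 4 * w) * (1 + (norm h)\<^sup>2) / y"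
    by (simp add: add_divide_distrib algebra_simps)
  finally show ?thesis .
qed

text \<open>ln x = 2 ln (sqrt x) <= 2 sqrt x; a square root is crude but combines easily with powers
  of norm h. The term \<open>\<bar>ln r\<bar>\<close> covers small norm z, and pi covers the
  argument.\<close>

lemma norm_Ln_le:
  assumes "0 < r" "r \<le> norm z"
  shows "norm (Ln z) \<le> 2 * sqrt (norm z) + \<bar>ln r\<bar> + pi"
proof -
  have z: "z \<noteq> 0" using assms by auto
  have "norm (Ln z) \<le> \<bar>Re (Ln z)\<bar> + \<bar>Im (Ln z)\<bar>" by (rule cmod_le)
  moreover have "\<bar>Im (Ln z)\<bar> \<le> pi"
    using mpi_less_Im_Ln[OF z] Im_Ln_le_pi[OF z] by linarith
  moreover have "\<bar>Re (Ln z)\<bar> \<le> 2 * sqrt (norm z) + \<bar>ln r\<bar>"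
  proof -
    have "ln (norm z) = 2 * ln (sqrt (norm z))" using z by (simp add: ln_sqrt)
    also have "\<dots> \<le> 2 * sqrt (norm z)" using z by (intro mult_left_mono ln_bound) auto
    finally have "ln (norm z) \<le> 2 * sqrt (norm z)" .
    moreover have "ln r \<le> ln (norm z)" using assms by (intro ln_mono) auto
    moreover have "0 \<le> sqrt (norm z)" by simp
    ultimately show ?thesis using z unfolding Re_Ln[OF z] by linarith
  qed
  ultimately show ?thesis by linarith
qed

text \<open>Far below \<open>s\<close> no cancellation is needed: \<open>Digamma\<close> and \<open>Ln\<close> are \<open>O(sqrt (norm h))\<close> on the
  vertical segment, and \<open>norm h powr (3/2)\<close> is \<open>O((norm h)\<^sup>2 / sqrt (Im s))\<close> there.\<close>
lemma ln_Gamma_shift_far: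
  fixes w :: real and \<mu> s h :: complex
  defines "y \<equiv> Im s"
  defines "K \<equiv> 2 * sqrt (5 * w + norm \<mu>) + \<bar>ln (2 * w)\<bar> + pi + 8 * (1 / (2 * w) + 1 / (2 * w)\<^sup>2) + 2 * sqrt (4 * w) + \<bar>ln 4\<bar> + pi"
  assumes w: "0 < w" and mu: "0 \<le> Re \<mu>" and y: "4 \<le> w * y" "2 \<le> y"
    and s: "\<bar>Re s\<bar> \<le> y" and h: "0 \<le> Re h" "2 \<le> Re (s + h)" "Im h \<le> - y / 2"
  shows "norm (ln_Gamma (w * (s + h) + \<mu>) - ln_Gamma (w * (s + Re h) + \<mu>) - w * (h - Re h) * Ln (w * s))
           \<le> 2 * w * K * (norm h)\<^sup>2 / sqrt y"
proof -
  have y0: "0 < y" using y(2) by simp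
  have h1: "y / 2 \<le> norm h" using h(3) abs_Im_le_cmod[of h] by linarith
  then have h2: "1 \<le> norm h" using y by linarith
  have s1: "norm s \<le> 4 * norm h" using cmod_le[of s] s y0 h1 unfolding y_def by linarith
  \<comment> \<open>Since Re (s + h) >= 2 and Re \<mu> >= 0, the vertical segment has real part at
    least 2 w, hence avoids poles and cut even when it crosses the real axis. The ball gives norm
    \<zeta> = O(norm h), because here y <= 2 norm h.\<close>
  define T where "T = {\<zeta>. 2 * w \<le> Re \<zeta>} \<inter> cball (w * s + \<mu>) (w * norm h)"
  have "norm (ln_Gamma (w * (s + h) + \<mu>) - ln_Gamma (w * (s + Re h) + \<mu>) - (w * (s + h) + \<mu> - (w * (s + Re h) + \<mu>)) * Ln (w * s))
     \<le> K * sqrt (norm h) * norm (w * (s + h) + \<mu> - (w * (s + Re h) + \<mu>))"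
  proof (rule ln_Gamma_diff_bound)
    show "convex T" unfolding T_def by (intro convex_Int convex_halfspace_Re_ge convex_cball)
    have "w * 2 \<le> w * Re (s + h)" using w h by (intro mult_left_mono) auto
    moreover have "w * Re h \<le> w * norm h" using w by (intro mult_left_mono complex_Re_le_cmod) auto
    ultimately show "w * (s + Re h) + \<mu> \<in> T" "w * (s + h) + \<mu> \<in> T"
      unfolding T_def using mu w h(1) by (auto simp: dist_norm norm_mult algebra_simps)
  next
    fix \<zeta> assume z: "\<zeta> \<in> T"
    then have Rz: "2 * w \<le> Re \<zeta>" by (simp add: T_def)
    then show "\<zeta> \<notin> \<real>\<^sub>\<le>\<^sub>0" using w by (auto elim!: nonpos_Reals_cases)
    have nz: "2 * w \<le> norm \<zeta>" using Rz complex_Re_le_cmod[of \<zeta>] by linarith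
    have "norm \<zeta> \<le> norm (\<zeta> - (w * s + \<mu>)) + norm (w * s) + norm \<mu>"
      using norm_triangle_ineq[of "\<zeta> - (w * s + \<mu>)" "w * s + \<mu>"] norm_triangle_ineq[of "w * s" \<mu>] by simp
    also have "\<dots> \<le> w * norm h + w * norm s + norm \<mu>"
      using z w by (simp add: T_def dist_norm norm_minus_commute norm_mult)
    also have "\<dots> \<le> w * norm h + w * (4 * norm h) + norm \<mu> * norm h"
      using s1 h2 w by (intro add_mono mult_left_mono) (auto simp: mult_le_cancel_left1)
    also have "\<dots> = (5 * w + norm \<mu>) * norm h" by (simp add: algebra_simps)
    finally have "sqrt (norm \<zeta>) \<le> sqrt ((5 * w + norm \<mu>) * norm h)"
      by (rule real_sqrt_le_mono)
    then have "2 * sqrt (norm \<zeta>) \<le> 2 * sqrt (5 * w + norm \<mu>) * sqrt (norm h)"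
      unfolding real_sqrt_mult by linarith
    moreover have "norm (Ln \<zeta>) \<le> 2 * sqrt (norm \<zeta>) + \<bar>ln (2 * w)\<bar> + pi"
      using w by (intro norm_Ln_le[OF _ nz]) auto
    ultimately have L1: "norm (Ln \<zeta>) \<le> 2 * sqrt (5 * w + norm \<mu>) * sqrt (norm h) + \<bar>ln (2 * w)\<bar> + pi" by linarith
    have "norm (Digamma \<zeta> - Ln \<zeta>) \<le> 8 * (1 / norm \<zeta> + 1 / (norm \<zeta>)\<^sup>2)"
      using Rz w nz by (intro norm_Digamma_minus_Ln_le) auto
    also have "\<dots> \<le> 8 * (1 / (2 * w) + 1 / (2 * w)\<^sup>2)"
      using nz w less_le_trans[OF _ nz]
      by (intro mult_left_mono add_mono divide_left_mono power_mono mult_pos_pos zero_less_power) auto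
    finally have L2: "norm (Digamma \<zeta> - Ln \<zeta>) \<le> 8 * (1 / (2 * w) + 1 / (2 * w)\<^sup>2)" .
    have "w * y \<le> w * norm s"
      using w abs_Im_le_cmod[of s] unfolding y_def by (intro mult_left_mono) auto
    moreover have "norm (w * s) = w * norm s" using w by (simp add: norm_mult)
    ultimately have "4 \<le> norm (w * s)"
      using y(1) by linarith
    then have "norm (Ln (w * s)) \<le> 2 * sqrt (norm (w * s)) + \<bar>ln 4\<bar> + pi"
      by (intro norm_Ln_le) auto
    moreover have "norm (w * s) \<le> 4 * w * norm h" using s1 w by (simp add: norm_mult)
    then have "sqrt (norm (w * s)) \<le> sqrt ((4 * w) * norm h)" by (intro real_sqrt_le_mono)
    then have "2 * sqrt (norm (w * s)) \<le> 2 * sqrt (4 * w) * sqrt (norm h)"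
      unfolding real_sqrt_mult[of "4 * w"] by linarith
    ultimately have L3: "norm (Ln (w * s)) \<le> 2 * sqrt (4 * w) * sqrt (norm h) + \<bar>ln 4\<bar> + pi" by linarith
    have sq1: "1 \<le> sqrt (norm h)" using h2 by simp
    define K' where "K' = \<bar>ln (2 * w)\<bar> + pi + 8 * (1 / (2 * w) + 1 / (2 * w)\<^sup>2) + \<bar>ln 4\<bar> + pi"
    have "0 \<le> K'" unfolding K'_def using w pi_gt_zero by (intro add_nonneg_nonneg) auto
    then have K': "K' \<le> K' * sqrt (norm h)" using sq1 by (simp add: mult_le_cancel_left1)
    have Keq: "K * sqrt (norm h) = 2 * sqrt (5 * w + norm \<mu>) * sqrt (norm h) + 2 * sqrt (4 * w) * sqrt (norm h) + K' * sqrt (norm h)"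
      unfolding K_def K'_def by (simp only: distrib_right)
    have "norm (Digamma \<zeta> - Ln (w * s)) \<le> norm (Digamma \<zeta> - Ln \<zeta>) + norm (Ln \<zeta>) + norm (Ln (w * s))"
      using norm_triangle_ineq[of "Digamma \<zeta> - Ln \<zeta>" "Ln \<zeta>"] norm_triangle_ineq4[of "Digamma \<zeta>" "Ln (w * s)"] by simp
    also have "\<dots> \<le> K * sqrt (norm h)" using L1 L2 L3 K' unfolding Keq K'_def by linarith
    finally show "norm (Digamma \<zeta> - Ln (w * s)) \<le> K * sqrt (norm h)" .
  qed
  also have "(w * (s + h) + \<mu> - (w * (s + Re h) + \<mu>)) = w * (h - Re h)" by (simp add: algebra_simps)
  also have "K * sqrt (norm h) * norm (w * (h - Re h)) \<le> K * sqrt (norm h) * (w * norm h)"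
  proof (intro mult_left_mono)
    have "norm (h - Re h) \<le> norm h" by (simp add: cmod_def)
    then show "norm (w * (h - Re h)) \<le> w * norm h" using w by (simp add: norm_mult)
  qed (use w pi_gt_zero in \<open>auto simp: K_def intro!: add_nonneg_nonneg\<close>)
  also have "\<dots> = w * K * (norm h)\<^sup>2 * (1 / sqrt (norm h))"
  proof -
    have "sqrt (norm h) * sqrt (norm h) = norm h" by simp
    moreover have "0 < sqrt (norm h)" using less_le_trans[OF zero_less_one h2] by (simp only: real_sqrt_gt_0_iff)
    ultimately show ?thesis by (simp add: field_simps power2_eq_square)
  qed
  also have "\<dots> \<le> w * K * (norm h)\<^sup>2 * (2 / sqrt y)"
  proof (intro mult_left_mono)
    have "sqrt y \<le> sqrt (4 * norm h)" using h1 y0 by simp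
    then have "sqrt y \<le> 2 * sqrt (norm h)" by (simp add: real_sqrt_mult)
    moreover have "0 < sqrt y" "0 < sqrt (norm h)" using h2 y0 by auto
    ultimately show "1 / sqrt (norm h) \<le> 2 / sqrt y" by (simp add: field_simps)
  qed (use w pi_gt_zero in \<open>auto simp: K_def intro!: add_nonneg_nonneg mult_nonneg_nonneg\<close>)
  finally show ?thesis by (simp add: mult_ac)
qed

text \<open>The error is stated as an exponent \<open>g\<close> so that the errors of several Gamma
  factors add up. Quadratic growth in h is admissible because a Gaussian in h follows.\<close>

proposition Gamma_shift_asymptotics:
  fixes w :: real and \<mu> :: complex
  assumes w: "0 < w" and mu: "0 \<le> Re \<mu>"
  obtains K Y where "0 < K" "0 < Y"
    "\<And>(s :: complex) (h :: complex). \<lbrakk>Y \<le> Im s; \<bar>Re s\<bar> \<le> Im s / 8; 0 \<le> Re h; 2 \<le> Re (s + h)\<rbrakk> \<Longrightarrow>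
       Gamma (w * s + \<mu>) \<noteq> 0 \<and>
       (\<exists>g :: complex. Gamma (w * (s + h) + \<mu>) = Gamma (w * s + \<mu>) * exp (w * h * Ln (w * s) + g) \<and>
            norm g \<le> K * (1 + (norm h)\<^sup>2) / sqrt (Im s))"
proof -
  define K1 where "K1 = 64 + 4 * norm \<mu> + 4 * w"
  define K2 where "K2 = 2 * w * (2 * sqrt (5 * w + norm \<mu>) + \<bar>ln (2 * w)\<bar> + pi + 8 * (1 / (2 * w) + 1 / (2 * w)\<^sup>2) + 2 * sqrt (4 * w) + \<bar>ln 4\<bar> + pi)"
  have K1: "0 < K1" unfolding K1_def using w by (simp add: add_pos_nonneg)
  have K2: "0 \<le> K2" unfolding K2_def using w pi_gt_zero by (intro mult_nonneg_nonneg add_nonneg_nonneg) auto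
  \<comment> \<open>The summands give 2 <= y, 4 <= w y and 4 norm \<mu> <= w y.\<close>
  define Y where "Y = 2 + 4 / w + 4 * norm \<mu> / w"
  show ?thesis
  proof (rule that[of "K1 + K2" Y])
    fix s h :: complex
    assume y: "Y \<le> Im s" and s: "\<bar>Re s\<bar> \<le> Im s / 8" and h: "0 \<le> Re h" "2 \<le> Re (s + h)"
    define y where "y = Im s"
    have yy: "2 \<le> y" "4 / w \<le> y" "4 * norm \<mu> / w \<le> y"
    proof -
      have "0 \<le> 4 / w" "0 \<le> 4 * norm \<mu> / w" using w by auto
      then show "2 \<le> y" "4 / w \<le> y" "4 * norm \<mu> / w \<le> y" using y unfolding y_def Y_def by linarith+
    qed
    then have wy: "4 \<le> w * y" "4 * norm \<mu> \<le> w * y" using w by (auto simp: field_simps)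
    have s': "- y / 8 \<le> Re s" "\<bar>Re s\<bar> \<le> y" using s yy by (auto simp: y_def)
    \<comment> \<open>Re s may be negative, so the poles are avoided by means of the imaginary
      part.\<close>
    have "\<bar>Im \<mu>\<bar> < w * y" using abs_Im_le_cmod[of \<mu>] wy by linarith
    then have "0 < Im (w * s + \<mu>)" by (simp add: y_def)
    then have zn: "w * s + \<mu> \<notin> \<int>\<^sub>\<le>\<^sub>0" by (metis Im_complex_of_real less_irrefl nonpos_Ints_cases of_real_of_int_eq)
    have zhn: "w * (s + h) + \<mu> \<notin> \<int>\<^sub>\<le>\<^sub>0"
    proof (rule not_nonpos_Ints_Re_pos)
      have "0 < w * Re (s + h)" using w h by (intro mult_pos_pos) auto
      moreover have "Re (w * (s + h) + \<mu>) = w * Re (s + h) + Re \<mu>" by simp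
      ultimately show "0 < Re (w * (s + h) + \<mu>)" using mu by linarith
    qed
    define g where "g = ln_Gamma (w * (s + h) + \<mu>) - ln_Gamma (w * s + \<mu>) - w * h * Ln (w * s)"
    have sy: "1 / y \<le> 1 / sqrt y"
      using yy sqrt_le_self[of y] by (intro divide_left_mono) auto
    have near: "norm (ln_Gamma (w * (s + h') + \<mu>) - ln_Gamma (w * s + \<mu>) - w * h' * Ln (w * s)) \<le> K1 * (1 + (norm h')\<^sup>2) / sqrt y"
      if "0 \<le> Re h'" "- y / 2 \<le> Im h'" for h' :: complex
    proof -
      have "norm (ln_Gamma (w * (s + h') + \<mu>) - ln_Gamma (w * s + \<mu>) - w * h' * Ln (w * s)) \<le> K1 * (1 + (norm h')\<^sup>2) / y"
        unfolding K1_def y_def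
        by (rule ln_Gamma_shift_near) (use w mu wy s' that in \<open>auto simp: y_def\<close>)
      also have "\<dots> \<le> K1 * (1 + (norm h')\<^sup>2) / sqrt y"
        using mult_left_mono[OF sy, of "K1 * (1 + (norm h')\<^sup>2)"] K1 by simp
      finally show ?thesis .
    qed
    have "norm g \<le> (K1 + K2) * (1 + (norm h)\<^sup>2) / sqrt y"
    proof (cases "- y / 2 \<le> Im h")
      case True
      have "norm g \<le> K1 * (1 + (norm h)\<^sup>2) / sqrt y" unfolding g_def by (rule near) fact+
      also have "\<dots> \<le> (K1 + K2) * (1 + (norm h)\<^sup>2) / sqrt y"
        using K2 yy by (intro divide_right_mono mult_right_mono) auto
      finally show ?thesis .
    next
      case False
      \<comment> \<open>For h far below, go first horizontally to s + Re h, where the near estimate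
        applies, and then vertically down.\<close>
      have g: "g = (ln_Gamma (w * (s + Re h) + \<mu>) - ln_Gamma (w * s + \<mu>) - w * Re h * Ln (w * s)) +
            (ln_Gamma (w * (s + h) + \<mu>) - ln_Gamma (w * (s + Re h) + \<mu>) - w * (h - Re h) * Ln (w * s))"
        unfolding g_def by (simp add: algebra_simps)
      have "norm (complex_of_real (Re h)) \<le> norm h" by (simp add: abs_Re_le_cmod)
      then have "K1 * (1 + (norm (complex_of_real (Re h)))\<^sup>2) / sqrt y \<le> K1 * (1 + (norm h)\<^sup>2) / sqrt y"
        using K1 yy by (intro divide_right_mono mult_left_mono add_left_mono power_mono) auto
      then have g1: "norm (ln_Gamma (w * (s + Re h) + \<mu>) - ln_Gamma (w * s + \<mu>) - w * Re h * Ln (w * s)) \<le> K1 * (1 + (norm h)\<^sup>2) / sqrt y"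
        using near[of "Re h"] h yy by simp
      have "norm (ln_Gamma (w * (s + h) + \<mu>) - ln_Gamma (w * (s + Re h) + \<mu>) - w * (h - Re h) * Ln (w * s)) \<le> K2 * (norm h)\<^sup>2 / sqrt y"
        unfolding K2_def y_def
        by (rule ln_Gamma_shift_far) (use w mu wy s' h yy False in \<open>auto simp: y_def\<close>)
      also have "\<dots> \<le> K2 * (1 + (norm h)\<^sup>2) / sqrt y"
        using K2 yy by (intro divide_right_mono mult_left_mono) auto
      finally show ?thesis unfolding g using g1
        by (intro norm_triangle_le) (simp add: add_divide_distrib algebra_simps)
    qed
    moreover have "Gamma (w * (s + h) + \<mu>) = Gamma (w * s + \<mu>) * exp (w * h * Ln (w * s) + g)"
      unfolding g_def Gamma_complex_altdef using zn zhn by (simp add: exp_diff exp_add)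
    ultimately show "Gamma (w * s + \<mu>) \<noteq> 0 \<and>
       (\<exists>g :: complex. Gamma (w * (s + h) + \<mu>) = Gamma (w * s + \<mu>) * exp (w * h * Ln (w * s) + g) \<and>
            norm g \<le> (K1 + K2) * (1 + (norm h)\<^sup>2) / sqrt (Im s))"
      using Gamma_nonzero[OF zn] unfolding y_def by blast
  qed (use K1 K2 w in \<open>auto simp: Y_def add_pos_nonneg\<close>)
qed

section \<open>Phragmen-Lindelof, Gaussian integrals and shifting vertical lines\<close>

lemma eventually_power_le_exp:
  fixes D \<delta> \<kappa> b :: real
  assumes "0 < \<delta>" "0 < \<kappa>"
  shows "eventually (\<lambda>v. D * (1 + v) ^ N - \<delta> * exp (\<kappa> * v) \<le> b) at_top"
proof -
  have "filterlim (\<lambda>v. \<kappa> * (1 + v)) at_top at_top"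
    using assms by real_asymp
  then have "((\<lambda>v. (\<kappa> * (1 + v)) ^ N / exp (\<kappa> * (1 + v))) \<longlongrightarrow> 0) at_top"
    by (rule filterlim_compose[OF tendsto_power_div_exp_0])
  then have "((\<lambda>v. D * exp \<kappa> / \<kappa> ^ N * ((\<kappa> * (1 + v)) ^ N / exp (\<kappa> * (1 + v)))) \<longlongrightarrow> D * exp \<kappa> / \<kappa> ^ N * 0) at_top"
    by (intro tendsto_intros)
  then have "eventually (\<lambda>v. D * exp \<kappa> / \<kappa> ^ N * ((\<kappa> * (1 + v)) ^ N / exp (\<kappa> * (1 + v))) < \<delta> / 2) at_top"
    using assms by (intro order_tendstoD(2)) auto
  moreover have "eventually (\<lambda>v. - b \<le> \<delta> / 2 * exp (\<kappa> * v)) at_top"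
  proof -
    have "filterlim (\<lambda>v. \<delta> / 2 * exp (\<kappa> * v)) at_top at_top"
      using assms by real_asymp
    then show ?thesis unfolding filterlim_at_top by blast
  qed
  ultimately show ?thesis
  proof eventually_elim
    case (elim v)
    have "D * exp \<kappa> / \<kappa> ^ N * ((\<kappa> * (1 + v)) ^ N / exp (\<kappa> * (1 + v))) * exp (\<kappa> * v) = D * (1 + v) ^ N"
      using assms unfolding power_mult_distrib by (simp add: distrib_left exp_add)
    moreover have "D * exp \<kappa> / \<kappa> ^ N * ((\<kappa> * (1 + v)) ^ N / exp (\<kappa> * (1 + v))) * exp (\<kappa> * v) \<le> \<delta> / 2 * exp (\<kappa> * v)"
      using elim by (intro mult_right_mono) auto
    ultimately show ?case using elim by linarith
  qed
qed

text \<open>Growth is used only on the horizontal sides of tall rectangles. Asking for it only when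
  |Im z| >= 1 keeps the point s = 1 out of the growth estimates for \<open>xi\<close>.\<close>

proposition phragmen_lindelof_strip:
  fixes f :: "complex \<Rightarrow> complex"
  assumes hol: "f holomorphic_on UNIV" and B: "0 < B"
    and edge: "\<And>z. Re z = a \<or> Re z = b \<Longrightarrow> norm (f z) \<le> B"
    and growth: "\<And>z. a \<le> Re z \<Longrightarrow> Re z \<le> b \<Longrightarrow> 1 \<le> \<bar>Im z\<bar> \<Longrightarrow> norm (f z) \<le> exp (D * (1 + \<bar>Im z\<bar>) ^ N)"
    and z: "a \<le> Re z" "Re z \<le> b"
  shows "norm (f z) \<le> B"
proof -
  \<comment> \<open>This makes |\<kappa> x| <= 1 < pi / 3 across the strip, so the cosine there is
    at least 1/2.\<close>
  define \<kappa> where "\<kappa> = 1 / (\<bar>a\<bar> + \<bar>b\<bar> + 1)"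
  have \<kappa>: "0 < \<kappa>" by (simp add: \<kappa>_def add_nonneg_pos)
  have cosk: "1 / 2 \<le> cos (\<kappa> * x)" if "a \<le> x" "x \<le> b" for x
  proof -
    have "\<bar>\<kappa> * x\<bar> \<le> 1" using that by (auto simp: \<kappa>_def field_simps abs_mult)
    then have "\<bar>\<kappa> * x\<bar> \<le> pi / 3" "pi / 3 \<le> pi" using pi_gt3 by linarith+
    then have "cos (pi / 3) \<le> cos \<bar>\<kappa> * x\<bar>" by (intro cos_monotone_0_pi_le) auto
    then show ?thesis by (simp add: cos_60)
  qed
  \<comment> \<open>The factor decays doubly exponentially in the strip and has norm at most 1 there,
    so the edge bound survives and \<open>\<epsilon>\<close> can tend to 0.\<close>
  define g where "g = (\<lambda>\<epsilon> z. f z * exp (- (of_real \<epsilon> * cos (of_real \<kappa> * z))))"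
  have norm_g: "norm (g \<epsilon> w) \<le> norm (f w) * exp (- (\<epsilon> / 4 * exp (\<kappa> * \<bar>Im w\<bar>)))"
    if e: "0 < \<epsilon>" and w: "a \<le> Re w" "Re w \<le> b" for \<epsilon> w
  proof -
    define X where "X = exp (\<kappa> * \<bar>Im w\<bar>)"
    define Y where "Y = exp (\<kappa> * Im w) + exp (- (\<kappa> * Im w))"
    have "X \<le> Y" "0 \<le> X" unfolding X_def Y_def
      by (cases "0 \<le> Im w") simp_all
    moreover have "0 \<le> cos (\<kappa> * Re w)" using cosk[OF w] by linarith
    ultimately have "1 / 2 * X \<le> cos (\<kappa> * Re w) * Y"
      by (intro mult_mono cosk[OF w])
    also have "\<dots> = 2 * Re (cos (of_real \<kappa> * w))"
      by (simp add: Re_cos Y_def)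
    finally have "X / 4 \<le> Re (cos (of_real \<kappa> * w))" by simp
    then have "\<epsilon> / 4 * exp (\<kappa> * \<bar>Im w\<bar>) \<le> \<epsilon> * Re (cos (of_real \<kappa> * w))"
      using mult_left_mono[of "X / 4" _ \<epsilon>] e by (simp add: X_def)
    then show ?thesis by (simp add: g_def norm_mult mult_left_mono)
  qed
  have g_le: "norm (g \<epsilon> z) \<le> B" if e: "0 < \<epsilon>" for \<epsilon>
  proof -
    have "eventually (\<lambda>v. D * (1 + v) ^ N - \<epsilon> / 4 * exp (\<kappa> * v) \<le> ln B) at_top"
      by (rule eventually_power_le_exp) (use \<kappa> e in auto)
    then obtain V0 where V0: "\<And>v. V0 \<le> v \<Longrightarrow> D * (1 + v) ^ N - \<epsilon> / 4 * exp (\<kappa> * v) \<le> ln B"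
      by (auto simp: eventually_at_top_linorder)
    define V where "V = Max {V0, 1, \<bar>Im z\<bar> + 1}"
    have V: "V0 \<le> V" "1 \<le> V" "\<bar>Im z\<bar> < V" unfolding V_def by auto
    show ?thesis
    proof (rule maximum_modulus_frontier[of "g \<epsilon>" "cbox (Complex a (- V)) (Complex b V)"])
      show "g \<epsilon> holomorphic_on interior (cbox (Complex a (- V)) (Complex b V))"
        unfolding g_def by (intro holomorphic_intros holomorphic_on_subset[OF hol]) auto
      show "continuous_on (closure (cbox (Complex a (- V)) (Complex b V))) (g \<epsilon>)"
        unfolding g_def by (intro continuous_intros holomorphic_on_imp_continuous_on holomorphic_on_subset[OF hol]) auto
      show "z \<in> cbox (Complex a (- V)) (Complex b V)"
        using z V by (auto simp: in_cbox_complex_iff)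
    next
      fix w assume "w \<in> frontier (cbox (Complex a (- V)) (Complex b V))"
      then have w: "a \<le> Re w" "Re w \<le> b" and cases: "Re w = a \<or> Re w = b \<or> \<bar>Im w\<bar> = V"
        by (auto simp: frontier_cbox in_cbox_complex_iff in_box_complex_iff)
      note ng = norm_g[OF e w]
      show "norm (g \<epsilon> w) \<le> B"
      proof (cases "Re w = a \<or> Re w = b")
        case True
        have "norm (f w) * exp (- (\<epsilon> / 4 * exp (\<kappa> * \<bar>Im w\<bar>))) \<le> B * 1"
          using e B by (intro mult_mono edge True) auto
        then show ?thesis using ng by simp
      next
        case False
        then have Im: "\<bar>Im w\<bar> = V" using cases by auto
        have "norm (f w) * exp (- (\<epsilon> / 4 * exp (\<kappa> * \<bar>Im w\<bar>)))
                \<le> exp (D * (1 + V) ^ N) * exp (- (\<epsilon> / 4 * exp (\<kappa> * V)))"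
          using growth[OF w] V Im by simp
        also have "\<dots> = exp (D * (1 + V) ^ N - \<epsilon> / 4 * exp (\<kappa> * V))"
          by (simp only: exp_add [symmetric] diff_conv_add_uminus)
        also have "\<dots> \<le> exp (ln B)" using V0[OF V(1)] by simp
        finally show ?thesis using ng B by simp
      qed
    qed (rule bounded_cbox)
  qed
  have "((\<lambda>\<epsilon>. norm (g \<epsilon> z)) \<longlongrightarrow> norm (f z * exp (- (of_real 0 * cos (of_real \<kappa> * z))))) (at_right 0)"
    unfolding g_def by (intro tendsto_intros)
  then show ?thesis
    by (intro tendsto_upperbound[of _ _ "at_right 0"])
       (auto intro!: eventually_mono[OF eventually_at_right_less] g_le)
qed

text \<open>The substitution u = t + c x completes the square for the real part of b and rescales to
  the standard normal density. The imaginary part is left as a phase, evaluated by the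
  characteristic function, so no contour has to be moved.\<close>

lemma
  fixes b :: complex
  assumes a: "0 < a"
  shows integrable_complex_gaussian: "integrable lborel (\<lambda>u. exp (- of_real (a * u\<^sup>2) + b * of_real u))"
    and integral_complex_gaussian:
      "(LINT u|lborel. exp (- of_real (a * u\<^sup>2) + b * of_real u)) = of_real (sqrt (pi / a)) * exp (b\<^sup>2 / (4 * of_real a))"
proof -
  define q where "q = Im b"
  define p where "p = Re b"
  have b: "b = of_real p + \<i> * of_real q" by (simp add: complex_eq_iff p_def q_def)
  define c where "c = 1 / sqrt (2 * a)"
  define t where "t = p / (2 * a)"
  have c: "0 < c" "c\<^sup>2 = 1 / (2 * a)" using a by (auto simp: c_def power_divide)
  define \<gamma> where "\<gamma> = of_real (sqrt (2 * pi)) * exp (of_real (p\<^sup>2 / (4 * a)) + \<i> * of_real (q * p / (2 * a)))"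
  define G where "G = (\<lambda>u. exp (- of_real (a * u\<^sup>2) + b * of_real u))"
  have G: "G (t + c * x) = \<gamma> * (std_normal_density x *\<^sub>R exp (\<i> * of_real (q * c * x)))" for x
  proof -
    have "- (a * (t + c * x)\<^sup>2) + p * (t + c * x) = p\<^sup>2 / (4 * a) - x\<^sup>2 / 2"
    proof -
      have "a * (t + c * x)\<^sup>2 = a * t\<^sup>2 + p * c * x + a * c\<^sup>2 * x\<^sup>2"
        using a by (simp add: power2_eq_square t_def algebra_simps)
      also have "a * c\<^sup>2 * x\<^sup>2 = x\<^sup>2 / 2" using a by (simp add: c)
      also have "a * t\<^sup>2 = p\<^sup>2 / (4 * a)" using a by (simp add: t_def power2_eq_square field_simps)
      finally have "a * (t + c * x)\<^sup>2 = p\<^sup>2 / (4 * a) + p * c * x + x\<^sup>2 / 2" .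
      moreover have "p * t = 2 * (p\<^sup>2 / (4 * a))" using a by (simp add: t_def power2_eq_square)
      ultimately show ?thesis by (simp add: algebra_simps)
    qed
    note re = this
    have "- of_real (a * (t + c * x)\<^sup>2) + b * of_real (t + c * x)
       = complex_of_real (- (a * (t + c * x)\<^sup>2) + p * (t + c * x)) + \<i> * of_real (q * (t + c * x))"
      unfolding b of_real_add of_real_minus of_real_mult distrib_right by (simp only: mult.assoc add.assoc)
    also have "\<dots> = of_real (p\<^sup>2 / (4 * a) - x\<^sup>2 / 2) + \<i> * of_real (q * (t + c * x))"
      by (simp only: re)
    also have "\<dots> = (of_real (p\<^sup>2 / (4 * a)) + \<i> * of_real (q * p / (2 * a))) + of_real (- x\<^sup>2 / 2) + \<i> * of_real (q * c * x)"
      by (simp add: complex_eq_iff t_def distrib_left)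
    finally have eq1: "G (t + c * x) = exp (of_real (p\<^sup>2 / (4 * a)) + \<i> * of_real (q * p / (2 * a))) * of_real (exp (- x\<^sup>2 / 2)) * exp (\<i> * of_real (q * c * x))"
      unfolding G_def by (simp only: exp_add exp_of_real)
    have eq2: "complex_of_real (sqrt (2 * pi)) * of_real (std_normal_density x) = of_real (exp (- x\<^sup>2 / 2))"
      unfolding of_real_mult [symmetric] std_normal_density_def by simp
    show ?thesis
      unfolding eq1 \<gamma>_def scaleR_conv_of_real eq2 [symmetric] by (simp only: mult_ac)
  qed
  have int: "integrable lborel (\<lambda>x. std_normal_density x *\<^sub>R exp (\<i> * of_real (q * c * x)))"
  proof (rule Bochner_Integration.integrable_bound[OF integrable_normal_density[of 1 0]])
    show "AE x in lborel. norm (std_normal_density x *\<^sub>R exp (\<i> * of_real (q * c * x))) \<le> norm (std_normal_density x)"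
      by simp
  qed simp_all
  have val: "(LINT x|lborel. std_normal_density x *\<^sub>R exp (\<i> * of_real (q * c * x))) = of_real (exp (- (q * c)\<^sup>2 / 2))"
  proof -
    have "(LINT x|lborel. std_normal_density x *\<^sub>R exp (\<i> * of_real (q * c * x))) = char std_normal_distribution (q * c)"
      unfolding char_def by (subst integral_density) auto
    then show ?thesis by (simp add: char_std_normal_distribution)
  qed
  have "integrable lborel (\<lambda>x. G (t + c * x))"
    unfolding G using int by (intro integrable_mult_right)
  then show "integrable lborel (\<lambda>u. exp (- of_real (a * u\<^sup>2) + b * of_real u))"
    using lborel_integrable_real_affine_iff[of c G t] c by (simp add: G_def)
  have "(LINT u|lborel. G u) = c *\<^sub>R (LINT x|lborel. G (t + c * x))"
    using lborel_integral_real_affine[of c G t] c by simp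
  also have "\<dots> = of_real (c * sqrt (2 * pi)) * (exp (of_real (p\<^sup>2 / (4 * a)) + \<i> * of_real (q * p / (2 * a))) * exp (of_real (- (q * c)\<^sup>2 / 2)))"
    unfolding G integral_mult_right_zero val \<gamma>_def
    by (simp only: scaleR_conv_of_real exp_of_real of_real_mult mult_ac)
  also have "c * sqrt (2 * pi) = sqrt (pi / a)"
    using a by (simp add: c_def real_sqrt_divide real_sqrt_mult)
  also have "exp (of_real (p\<^sup>2 / (4 * a)) + \<i> * of_real (q * p / (2 * a))) * exp (of_real (- (q * c)\<^sup>2 / 2)) = exp (b\<^sup>2 / (4 * of_real a))"
  proof -
    have eq: "- (q * c)\<^sup>2 / 2 = - (q\<^sup>2 / (4 * a))" by (simp add: power_mult_distrib c)
    have "of_real (p\<^sup>2 / (4 * a)) + \<i> * of_real (q * p / (2 * a)) + of_real (- (q\<^sup>2 / (4 * a))) = b\<^sup>2 / (4 * of_real a)"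
      unfolding b using a by (simp add: power2_eq_square field_simps)
    then show ?thesis unfolding exp_add [symmetric] eq by simp
  qed
  finally show "(LINT u|lborel. exp (- of_real (a * u\<^sup>2) + b * of_real u)) = of_real (sqrt (pi / a)) * exp (b\<^sup>2 / (4 * of_real a))"
    by (simp add: G_def)
qed

section \<open>The convolution formula and the shift of vertical lines\<close>

lemma integrable_inverse_1_plus_square_real: "integrable lborel (\<lambda>x::real. B / (1 + x\<^sup>2))"
proof -
  have "integrable lborel (\<lambda>x::real. inverse (1 + x\<^sup>2))"
    using integrable_inverse_1_plus_square by (simp add: set_integrable_def)
  then show ?thesis by (simp add: divide_inverse)
qed

lemma integral_gaussian_convolution:
  fixes g :: "real \<Rightarrow> complex" and z :: complex
  assumes g: "integrable lborel g" and a: "0 < a"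
  shows "(LINT u|lborel. of_real (exp (- a * u\<^sup>2)) * (LINT x|lborel. g x * exp (- \<i> * of_real x * of_real u)) * exp (\<i> * z * of_real u))
       = of_real (sqrt (pi / a)) * (LINT x|lborel. g x * exp (- (z - of_real x)\<^sup>2 / (4 * of_real a)))"
proof -
  have gm[measurable]: "g \<in> borel_measurable borel" using borel_measurable_integrable[OF g] by simp
  define E where "E = (\<lambda>x u. exp (- of_real (a * u\<^sup>2) + \<i> * (z - of_real x) * of_real u))"
  define f where "f = (\<lambda>x u. g x * E x u)"
  \<comment> \<open>A real x changes only the phase of the kernel. The double integral of norms is
    therefore a product, which is what Fubini needs.\<close>
  have nE: "norm (E x u) = norm (E 0 u)" for x u
    by (simp add: E_def)
  have Eint: "integrable lborel (E x)" for x
    unfolding E_def by (rule integrable_complex_gaussian[OF a])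
  have fm[measurable]: "case_prod f \<in> borel_measurable (lborel \<Otimes>\<^sub>M lborel)"
    unfolding f_def E_def by measurable
  have "integrable (lborel \<Otimes>\<^sub>M lborel) (case_prod f)"
  proof (rule lborel_pair.Fubini_integrable)
    have "norm (f x u) = norm (g x) * norm (E 0 u)" for x u
      unfolding f_def norm_mult by (subst nE) (rule refl)
    then have "(\<lambda>x. LINT u|lborel. norm (f x u)) = (\<lambda>x. norm (g x) * (LINT u|lborel. norm (E 0 u)))"
      by simp
    then show "integrable lborel (\<lambda>x. LINT u|lborel. norm (case (x, u) of (x, xa) \<Rightarrow> f x xa))"
      using g by simp
    show "AE x in lborel. integrable lborel (\<lambda>u. case (x, u) of (x, xa) \<Rightarrow> f x xa)"
      using Eint by (simp add: f_def)
  qed measurable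
  then have "(LINT u|lborel. LINT x|lborel. f x u) = (LINT x|lborel. LINT u|lborel. f x u)"
    by (rule lborel_pair.Fubini_integral)
  also have "(\<lambda>x. LINT u|lborel. f x u) = (\<lambda>x. of_real (sqrt (pi / a)) * (g x * exp (- (z - of_real x)\<^sup>2 / (4 * of_real a))))"
  proof
    fix x
    have "(LINT u|lborel. f x u) = g x * (LINT u|lborel. E x u)" by (simp add: f_def)
    also have "\<dots> = g x * (of_real (sqrt (pi / a)) * exp ((\<i> * (z - of_real x))\<^sup>2 / (4 * of_real a)))"
      unfolding E_def by (simp only: integral_complex_gaussian[OF a])
    finally show "(LINT u|lborel. f x u) = of_real (sqrt (pi / a)) * (g x * exp (- (z - of_real x)\<^sup>2 / (4 * of_real a)))"
      by (simp add: power_mult_distrib)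
  qed
  also have "(\<lambda>u. LINT x|lborel. f x u) = (\<lambda>u. of_real (exp (- a * u\<^sup>2)) * (LINT x|lborel. g x * exp (- \<i> * of_real x * of_real u)) * exp (\<i> * z * of_real u))"
  proof
    fix u
    have "f x u = (of_real (exp (- a * u\<^sup>2)) * exp (\<i> * z * of_real u)) * (g x * exp (- \<i> * of_real x * of_real u))" for x
      unfolding f_def E_def by (simp add: exp_of_real [symmetric] exp_add [symmetric] algebra_simps)
    then show "(LINT x|lborel. f x u) = of_real (exp (- a * u\<^sup>2)) * (LINT x|lborel. g x * exp (- \<i> * of_real x * of_real u)) * exp (\<i> * z * of_real u)"
      by simp
  qed
  finally show ?thesis by simp
qed

text \<open>An entire f has a primitive P. Vertical integrals cut off at height n are differences of
  values of P, so two of them differ by the increments of P along the horizontal segments at heights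
  n and -n, which tend to 0 by \<open>dec\<close>.\<close>

proposition integral_vertical_line_shift:
  fixes f :: "complex \<Rightarrow> complex"
  assumes hol: "f holomorphic_on UNIV" and ac: "a \<le> c"
    and dec: "\<And>z. a \<le> Re z \<Longrightarrow> Re z \<le> c \<Longrightarrow> norm (f z) \<le> B / (1 + (Im z)\<^sup>2)"
  shows "(LINT v|lborel. f (of_real a + \<i> * of_real v)) = (LINT v|lborel. f (of_real c + \<i> * of_real v))"
proof -
  obtain P where P: "\<And>z. (P has_field_derivative f z) (at z)"
    using holomorphic_convex_primitive'[OF convex_UNIV open_UNIV hol] by auto
  have cont: "continuous_on S f" for S
    using holomorphic_on_imp_continuous_on[OF hol] continuous_on_subset by blast
  define I where "I = (\<lambda>x (n::nat). LINT v|lborel. indicator {- real n .. real n} v *\<^sub>R f (of_real x + \<i> * of_real v))"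
  have lim: "I x \<longlonglongrightarrow> (LINT v|lborel. f (of_real x + \<i> * of_real v))" if x: "a \<le> x" "x \<le> c" for x
    unfolding I_def
  proof (rule integral_dominated_convergence[where w = "\<lambda>v. B / (1 + v\<^sup>2)"])
    have c: "continuous_on UNIV (\<lambda>v. f (of_real x + \<i> * of_real v))"
      by (rule continuous_on_compose2[OF cont[of UNIV]]) (auto intro!: continuous_intros)
    then show m: "(\<lambda>v. f (of_real x + \<i> * of_real v)) \<in> borel_measurable lborel"
      by (simp add: borel_measurable_continuous_onI)
    show "(\<lambda>v. indicator {- real n .. real n} v *\<^sub>R f (of_real x + \<i> * of_real v)) \<in> borel_measurable lborel" for n
      using m by (intro borel_measurable_scaleR) auto
    show "integrable lborel (\<lambda>v. B / (1 + v\<^sup>2))" by (rule integrable_inverse_1_plus_square_real)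
    show "AE v in lborel. (\<lambda>n. indicator {- real n .. real n} v *\<^sub>R f (of_real x + \<i> * of_real v)) \<longlonglongrightarrow> f (of_real x + \<i> * of_real v)"
    proof (rule AE_I2, rule tendsto_eventually)
      fix v :: real
      obtain n0 where n0: "\<bar>v\<bar> \<le> real n0" using real_arch_simple by blast
      show "\<forall>\<^sub>F n in sequentially. indicator {- real n .. real n} v *\<^sub>R f (of_real x + \<i> * of_real v) = f (of_real x + \<i> * of_real v)"
        using eventually_ge_at_top[of n0]
      proof eventually_elim
        case (elim n)
        then have "\<bar>v\<bar> \<le> real n" using n0 by linarith
        then have "v \<in> {- real n .. real n}" by auto
        then show ?case by simp
      qed
    qed
    show "AE v in lborel. norm (indicator {- real n .. real n} v *\<^sub>R f (of_real x + \<i> * of_real v)) \<le> B / (1 + v\<^sup>2)" for n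
    proof (rule AE_I2)
      fix v :: real
      have 1: "norm (f (of_real x + \<i> * of_real v)) \<le> B / (1 + v\<^sup>2)"
        using dec[of "of_real x + \<i> * of_real v"] x by simp
      moreover have "0 \<le> B / (1 + v\<^sup>2)" using order_trans[OF norm_ge_zero 1] .
      ultimately show "norm (indicator {- real n .. real n} v *\<^sub>R f (of_real x + \<i> * of_real v)) \<le> B / (1 + v\<^sup>2)"
        by (auto simp: indicator_def)
    qed
  qed
  have I: "\<i> * I x n = P (of_real x + \<i> * of_real (real n)) - P (of_real x + \<i> * of_real (- real n))" for x n
  proof -
    have d: "((\<lambda>v. P (of_real x + \<i> * of_real v)) has_vector_derivative \<i> * f (of_real x + \<i> * of_real v)) (at v within A)" for v A
    proof -
      have "((\<lambda>w. P (of_real x + \<i> * w)) has_field_derivative f (of_real x + \<i> * of_real v) * \<i>) (at (of_real v))"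
        by (rule DERIV_chain2[OF P]) (auto intro!: derivative_eq_intros)
      then have "((\<lambda>w. P (of_real x + \<i> * of_real w)) has_vector_derivative f (of_real x + \<i> * of_real v) * \<i>) (at v)"
        by (rule has_vector_derivative_real_field)
      then show ?thesis by (auto simp: mult.commute intro: has_vector_derivative_at_within)
    qed
    have "(LINT v|lborel. indicator {- real n .. real n} v *\<^sub>R (\<i> * f (of_real x + \<i> * of_real v)))
          = P (of_real x + \<i> * of_real (real n)) - P (of_real x + \<i> * of_real (- real n))"
      by (rule integral_FTC_atLeastAtMost)
         (auto intro!: d continuous_intros continuous_on_compose2[OF cont[of UNIV]])
    then show ?thesis unfolding I_def by (simp add: mult_scaleR_right [symmetric] del: mult_scaleR_right)
  qed
  have hor: "norm (P (of_real c + \<i> * of_real v) - P (of_real a + \<i> * of_real v)) \<le> B / (1 + v\<^sup>2) * (c - a)" for v :: real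
  proof -
    define S where "S = {z. a \<le> Re z} \<inter> {z. Re z \<le> c} \<inter> ({z. v \<le> Im z} \<inter> {z. Im z \<le> v})"
    have "norm (P (of_real c + \<i> * of_real v) - P (of_real a + \<i> * of_real v))
        \<le> B / (1 + v\<^sup>2) * norm (of_real c + \<i> * of_real v - (of_real a + \<i> * of_real v))"
    proof (rule field_differentiable_bound[of S P f])
      show "convex S" unfolding S_def
        by (intro convex_Int convex_halfspace_Im_ge convex_halfspace_Re_ge convex_halfspace_Im_le convex_halfspace_Re_le)
      show "(P has_field_derivative f z) (at z within S)" for z
        using P has_field_derivative_at_within by blast
      show "norm (f z) \<le> B / (1 + v\<^sup>2)" if "z \<in> S" for z
        using dec[of z] that by (auto simp: S_def)
    qed (use ac in \<open>auto simp: S_def\<close>)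
    also have "of_real c + \<i> * of_real v - (of_real a + \<i> * of_real v) = of_real (c - a)" by simp
    finally show ?thesis using ac by (simp only: norm_of_real abs_of_nonneg diff_ge_0_iff_ge)
  qed
  have "(\<lambda>n. \<i> * I c n - \<i> * I a n) \<longlonglongrightarrow> 0"
  proof (rule Lim_null_comparison)
    show "\<forall>\<^sub>F n in sequentially. norm (\<i> * I c n - \<i> * I a n) \<le> 2 * (B / (1 + (real n)\<^sup>2) * (c - a))"
    proof (intro always_eventually allI)
      fix n
      have "\<i> * I c n - \<i> * I a n = (P (of_real c + \<i> * of_real (real n)) - P (of_real a + \<i> * of_real (real n)))
             - (P (of_real c + \<i> * of_real (- real n)) - P (of_real a + \<i> * of_real (- real n)))"
        unfolding I by simp
      also have "norm \<dots> \<le> B / (1 + (real n)\<^sup>2) * (c - a) + B / (1 + (- real n)\<^sup>2) * (c - a)"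
        by (intro norm_triangle_le_diff add_mono hor)
      finally show "norm (\<i> * I c n - \<i> * I a n) \<le> 2 * (B / (1 + (real n)\<^sup>2) * (c - a))" by simp
    qed
    show "(\<lambda>n. 2 * (B / (1 + (real n)\<^sup>2) * (c - a))) \<longlonglongrightarrow> 0" by real_asymp
  qed
  moreover have "(\<lambda>n. \<i> * I c n - \<i> * I a n) \<longlonglongrightarrow> \<i> * (LINT v|lborel. f (of_real c + \<i> * of_real v)) - \<i> * (LINT v|lborel. f (of_real a + \<i> * of_real v))"
    using ac by (intro tendsto_intros lim) auto
  ultimately have "\<i> * (LINT v|lborel. f (of_real c + \<i> * of_real v)) - \<i> * (LINT v|lborel. f (of_real a + \<i> * of_real v)) = 0"
    using LIMSEQ_unique by blast
  then show ?thesis by simp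
qed

section \<open>The completed function in vertical strips\<close>

text \<open>Finite-order growth as seen in a vertical strip, where norm z is O(1 + |Im z|). With 0
  <= D the exponent increases with N, which gives closure under products.\<close>

definition exp_poly_growth :: "complex set \<Rightarrow> (complex \<Rightarrow> complex) \<Rightarrow> bool" where
  "exp_poly_growth S f \<longleftrightarrow> (\<exists>D N. 0 \<le> D \<and> (\<forall>z\<in>S. norm (f z) \<le> exp (D * (1 + \<bar>Im z\<bar>) ^ N)))"

lemma exp_poly_growthI:
  assumes "\<And>z. z \<in> S \<Longrightarrow> norm (f z) \<le> exp (D * (1 + \<bar>Im z\<bar>) ^ N)"
  shows "exp_poly_growth S f"
  unfolding exp_poly_growth_def
proof (intro exI conjI ballI)
  fix z assume "z \<in> S"
  have "D * (1 + \<bar>Im z\<bar>) ^ N \<le> \<bar>D\<bar> * (1 + \<bar>Im z\<bar>) ^ N"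
    by (intro mult_right_mono) auto
  then show "norm (f z) \<le> exp (\<bar>D\<bar> * (1 + \<bar>Im z\<bar>) ^ N)"
    using assms[OF \<open>z \<in> S\<close>] by (meson exp_le_cancel_iff order_trans)
qed simp

lemma exp_poly_growth_bounded:
  assumes "\<And>z. z \<in> S \<Longrightarrow> norm (f z) \<le> B"
  shows "exp_poly_growth S f"
proof (rule exp_poly_growthI)
  fix z assume "z \<in> S"
  have "norm (f z) \<le> B" by (rule assms) fact
  also have "\<dots> \<le> exp B" using exp_ge_add_one_self[of B] by linarith
  finally show "norm (f z) \<le> exp (B * (1 + \<bar>Im z\<bar>) ^ 0)" by simp
qed

lemma exp_poly_growth_mult:
  assumes "exp_poly_growth S f" "exp_poly_growth S g"
  shows "exp_poly_growth S (\<lambda>z. f z * g z)"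
proof -
  obtain D N where f: "0 \<le> D" "\<And>z. z \<in> S \<Longrightarrow> norm (f z) \<le> exp (D * (1 + \<bar>Im z\<bar>) ^ N)"
    using assms(1) unfolding exp_poly_growth_def by blast
  obtain D' N' where g: "0 \<le> D'" "\<And>z. z \<in> S \<Longrightarrow> norm (g z) \<le> exp (D' * (1 + \<bar>Im z\<bar>) ^ N')"
    using assms(2) unfolding exp_poly_growth_def by blast
  show ?thesis
  proof (rule exp_poly_growthI)
    fix z assume z: "z \<in> S"
    have "norm (f z * g z) \<le> exp (D * (1 + \<bar>Im z\<bar>) ^ N) * exp (D' * (1 + \<bar>Im z\<bar>) ^ N')"
      unfolding norm_mult by (intro mult_mono f g z) auto
    also have "\<dots> = exp (D * (1 + \<bar>Im z\<bar>) ^ N + D' * (1 + \<bar>Im z\<bar>) ^ N')" by (simp add: exp_add)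
    also have "\<dots> \<le> exp (D * (1 + \<bar>Im z\<bar>) ^ (N + N') + D' * (1 + \<bar>Im z\<bar>) ^ (N + N'))"
      unfolding exp_le_cancel_iff using f(1) g(1) by (intro add_mono mult_left_mono power_increasing) auto
    finally show "norm (f z * g z) \<le> exp ((D + D') * (1 + \<bar>Im z\<bar>) ^ (N + N'))"
      by (simp add: distrib_right)
  qed
qed

lemma exp_poly_growth_power:
  "exp_poly_growth S f \<Longrightarrow> exp_poly_growth S (\<lambda>z. f z ^ n)"
  by (induction n) (auto intro: exp_poly_growth_mult exp_poly_growth_bounded[where B = 1])

lemma exp_poly_growth_prod:
  assumes "\<And>i. i \<in> I \<Longrightarrow> exp_poly_growth S (f i)"
  shows "exp_poly_growth S (\<lambda>z. \<Prod>i\<in>I. f i z)"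
  using assms
  by (induction I rule: infinite_finite_induct)
     (auto intro: exp_poly_growth_mult exp_poly_growth_bounded[where B = 1])

lemma norm_le_vertical:
  assumes "\<bar>Re z\<bar> \<le> c"
  shows "norm z \<le> (1 + c) * (1 + \<bar>Im z\<bar>)"
proof -
  have "norm z \<le> c + \<bar>Im z\<bar>" using cmod_le[of z] assms by linarith
  also have "\<dots> \<le> (1 + c) * (1 + \<bar>Im z\<bar>)" using assms by (simp add: algebra_simps)
  finally show ?thesis .
qed

lemma exp_poly_growth_linear:
  assumes "\<And>z. z \<in> S \<Longrightarrow> \<bar>Re z\<bar> \<le> c"
  shows "exp_poly_growth S (\<lambda>z. z + w)"
proof (rule exp_poly_growthI)
  fix z assume "z \<in> S"
  have "norm (z + w) \<le> (1 + c) * (1 + \<bar>Im z\<bar>) + norm w * (1 + \<bar>Im z\<bar>)"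
    by (intro norm_triangle_le add_mono norm_le_vertical assms \<open>z \<in> S\<close>) (simp add: distrib_left)
  also have "\<dots> = (1 + c + norm w) * (1 + \<bar>Im z\<bar>) ^ 1"
    by (simp add: algebra_simps)
  also have "\<dots> \<le> exp \<dots>"
    using exp_ge_add_one_self[of "(1 + c + norm w) * (1 + \<bar>Im z\<bar>) ^ 1"] by linarith
  finally show "norm (z + w) \<le> exp ((1 + c + norm w) * (1 + \<bar>Im z\<bar>) ^ 1)" .
qed

section \<open>Growth and decay of xi, and its heat flow as a line integral\<close>

locale extended_selberg =
  fixes a :: "nat \<Rightarrow> complex" and F :: "complex \<Rightarrow> complex" and m :: nat
    and \<alpha> :: complex and Q :: real and k :: nat and \<omega> :: "nat \<Rightarrow> real"
    and \<mu> :: "nat \<Rightarrow> complex" and xi :: "complex \<Rightarrow> complex"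
  assumes selberg_sharp: "selberg_sharp a F m \<alpha> Q k \<omega> \<mu> xi"
begin

abbreviation "\<gamma> \<equiv> gamma_fac m \<alpha> Q k \<omega> \<mu>"

lemma dirichlet_summable: "1 < Re s \<Longrightarrow> summable (\<lambda>n. norm (a (Suc n) / of_nat (Suc n) powr s))"
  and F_dirichlet: "1 < Re s \<Longrightarrow> F s = (\<Sum>n. a (Suc n) / of_nat (Suc n) powr s)"
  and alpha_nonzero: "\<alpha> \<noteq> 0" and Q_pos: "0 < Q" and k_pos: "0 < k"
  and omega_pos: "i < k \<Longrightarrow> 0 < \<omega> i" and Re_mu: "i < k \<Longrightarrow> 0 \<le> Re (\<mu> i)"
  and xi_holomorphic: "xi holomorphic_on UNIV"
  and xi_functional: "xi s = cnj (xi (1 - cnj s))"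
  using selberg_sharp unfolding selberg_sharp_def Suc_le_eq One_nat_def by blast+

lemma finite_order_extension:
  obtains G \<rho> A where "\<And>z. norm (G z) \<le> A * exp (norm z powr \<rho>)"
    "\<And>s. s \<noteq> 1 \<Longrightarrow> G s = (s - 1) ^ m * F s"
  using selberg_sharp unfolding selberg_sharp_def by blast

lemma Re_Gamma_arg_pos: "i < k \<Longrightarrow> 0 < Re s \<Longrightarrow> 0 < Re (of_real (\<omega> i) * s + \<mu> i)"
  using omega_pos[of i] Re_mu[of i] by (simp add: add_pos_nonneg)

lemma xi_eq:
  assumes "0 < Re s" "s \<noteq> 1"
  shows "xi s = \<gamma> s * F s"
proof -
  have "\<forall>i<k. of_real (\<omega> i) * s + \<mu> i \<notin> \<int>\<^sub>\<le>\<^sub>0"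
    using Re_Gamma_arg_pos[OF _ assms(1)] not_nonpos_Ints_Re_pos by blast
  then show ?thesis using selberg_sharp assms(2) unfolding selberg_sharp_def by blast
qed

lemma xi_continuous: "continuous_on S xi"
  using holomorphic_on_imp_continuous_on[OF xi_holomorphic] continuous_on_subset by blast

lemma norm_dirichlet_term_le:
  assumes "2 \<le> Re s"
  shows "norm (a (Suc n) / of_nat (Suc n) powr s) \<le> norm (a (Suc n) / of_nat (Suc n) powr 2)"
proof -
  have n: "norm (of_nat (Suc n) powr s) = real (Suc n) powr Re s" for s :: complex
    using norm_powr_real_powr'[of "of_nat (Suc n)" s] norm_powr_real_powr[of "of_nat (Suc n)" s] by simp
  have "real (Suc n) powr 2 \<le> real (Suc n) powr Re s" using assms by (intro powr_mono) auto
  then show ?thesis unfolding norm_divide n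
    by (intro divide_left_mono) (auto simp del: of_nat_Suc)
qed

lemma F_bounded:
  obtains M where "0 < M" "\<And>s. 2 \<le> Re s \<Longrightarrow> norm (F s) \<le> M"
proof -
  define M where "M = (\<Sum>n. norm (a (Suc n) / of_nat (Suc n) powr 2))"
  have s2: "summable (\<lambda>n. norm (a (Suc n) / of_nat (Suc n) powr 2))" by (rule dirichlet_summable) simp
  have "norm (F s) \<le> M" if "2 \<le> Re s" for s
  proof -
    have sm: "summable (\<lambda>n. norm (a (Suc n) / of_nat (Suc n) powr s))" using that by (intro dirichlet_summable) simp
    have "F s = (\<Sum>n. a (Suc n) / of_nat (Suc n) powr s)" using that by (intro F_dirichlet) simp
    also have "norm \<dots> \<le> (\<Sum>n. norm (a (Suc n) / of_nat (Suc n) powr s))" by (rule summable_norm[OF sm])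
    also have "\<dots> \<le> M" unfolding M_def
      using norm_dirichlet_term_le[OF that] by (intro suminf_le sm s2)
    finally show ?thesis .
  qed
  moreover have "0 \<le> M" unfolding M_def by (intro suminf_nonneg s2) auto
  ultimately show ?thesis by (intro that[of "M + 1"]) (force intro: add_increasing2)+
qed

text \<open>The map s to 1 - cnj s is reflection in the line Re s = 1/2 and keeps Im s, so bounds
  depending on Im s carry over to the other half of a strip.\<close>

lemma norm_xi_reflect: "norm (xi (1 - cnj s)) = norm (xi s)"
  using xi_functional[of s] by (metis complex_mod_cnj)

text \<open>The factor (s - 1)^m of \<open>\<gamma>\<close> turns F into the finite-order function
  G. The real parts of the Gamma arguments run through compact intervals of positive reals, so the
  Gamma factors are bounded.\<close>

lemma xi_growth_right:
  fixes c :: real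
  defines "S \<equiv> {z. 1 / 2 \<le> Re z \<and> Re z \<le> c \<and> 1 \<le> \<bar>Im z\<bar>}"
  shows "exp_poly_growth S xi"
proof -
  obtain G \<rho> A where G: "\<And>z. norm (G z) \<le> A * exp (norm z powr \<rho>)"
    "\<And>s. s \<noteq> 1 \<Longrightarrow> G s = (s - 1) ^ m * F s"
    using finite_order_extension by metis
  have ReS: "\<bar>Re z\<bar> \<le> c" if "z \<in> S" for z using that by (auto simp: S_def)
  \<comment> \<open>A natural exponent at least \<rho>; the comparison of powers uses norm z >= 1,
    true since |Im z| >= 1 on \<open>S\<close>.\<close>
  define N where "N = nat \<lceil>\<bar>\<rho>\<bar>\<rceil>"
  have A: "0 \<le> A" using order_trans[OF norm_ge_zero G(1)[of 0]] by (simp add: zero_le_mult_iff)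
  have growth_G: "exp_poly_growth S G"
  proof -
    have "exp_poly_growth S (\<lambda>z. of_real A * exp (of_real (norm z powr \<rho>)))"
    proof (intro exp_poly_growth_mult)
      show "exp_poly_growth S (\<lambda>z. of_real A)" by (rule exp_poly_growth_bounded[of _ _ A]) (use A in simp)
      show "exp_poly_growth S (\<lambda>z. exp (of_real (norm z powr \<rho>)))"
      proof (rule exp_poly_growthI)
        fix z assume z: "z \<in> S"
        have z1: "1 \<le> norm z" using z abs_Im_le_cmod[of z] by (auto simp: S_def)
        have "\<rho> \<le> real N" unfolding N_def using abs_ge_self[of \<rho>] real_nat_ceiling_ge[of "\<bar>\<rho>\<bar>"] by linarith
        then have "norm z powr \<rho> \<le> norm z powr real N" using z1 by (intro powr_mono)
        also have "\<dots> = norm z ^ N" using z1 by (intro powr_realpow) auto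
        also have "\<dots> \<le> ((1 + c) * (1 + \<bar>Im z\<bar>)) ^ N" by (intro power_mono norm_le_vertical ReS z) auto
        finally show "norm (exp (complex_of_real (norm z powr \<rho>))) \<le> exp ((1 + c) ^ N * (1 + \<bar>Im z\<bar>) ^ N)"
          by (simp add: power_mult_distrib)
      qed
    qed
    then obtain D N where D: "\<And>z. z \<in> S \<Longrightarrow> A * exp (norm z powr \<rho>) \<le> exp (D * (1 + \<bar>Im z\<bar>) ^ N)"
      unfolding exp_poly_growth_def using A by (auto simp: norm_mult)
    show ?thesis by (rule exp_poly_growthI) (rule order_trans[OF G(1) D])
  qed
  have "exp_poly_growth S (\<lambda>z. \<alpha> * z ^ m * of_real Q powr z * (\<Prod>i<k. Gamma (of_real (\<omega> i) * z + \<mu> i)) * G z)"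
  proof (intro exp_poly_growth_mult exp_poly_growth_power exp_poly_growth_prod growth_G)
    show "exp_poly_growth S (\<lambda>z. \<alpha>)" by (rule exp_poly_growth_bounded[OF order_refl])
    show "exp_poly_growth S (\<lambda>z. z)" using exp_poly_growth_linear[OF ReS, where w = 0] by simp
    show "exp_poly_growth S (\<lambda>z. of_real Q powr z)"
    proof (rule exp_poly_growth_bounded)
      fix z assume "z \<in> S"
      have "norm (of_real Q powr z) = exp (Re z * ln Q)"
        using Q_pos by (simp add: norm_powr_real_powr powr_def)
      also have "Re z * ln Q \<le> c * \<bar>ln Q\<bar>"
        using ReS[OF \<open>z \<in> S\<close>] abs_ge_self[of "Re z * ln Q"] mult_right_mono[of "\<bar>Re z\<bar>" c "\<bar>ln Q\<bar>"]
        by (simp add: abs_mult)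
      finally show "norm (of_real Q powr z) \<le> exp (c * \<bar>ln Q\<bar>)" by simp
    qed
  next
    fix i assume "i \<in> {..<k}"
    then have i: "i < k" by simp
    define J where "J = {\<omega> i / 2 .. \<omega> i * c + Re (\<mu> i)}"
    have J: "0 < r" if "r \<in> J" for r using that omega_pos[OF i] by (auto simp: J_def)
    have "continuous_on J (Gamma :: real \<Rightarrow> real)"
      using J by (intro continuous_on_Gamma) (force elim!: nonpos_Ints_cases)
    then have "bounded (Gamma ` J)"
      by (intro compact_imp_bounded compact_continuous_image) (auto simp: J_def)
    then obtain B where B: "\<And>r. r \<in> J \<Longrightarrow> norm (Gamma r) \<le> B" unfolding bounded_iff by auto
    show "exp_poly_growth S (\<lambda>z. Gamma (of_real (\<omega> i) * z + \<mu> i))"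
    proof (rule exp_poly_growth_bounded)
      fix z assume z: "z \<in> S"
      then have pos: "0 < Re z" by (auto simp: S_def)
      have "\<omega> i * (1 / 2) \<le> \<omega> i * Re z" "\<omega> i * Re z \<le> \<omega> i * c"
        using z omega_pos[OF i] by (auto simp: S_def intro!: mult_left_mono)
      moreover have "Re (of_real (\<omega> i) * z + \<mu> i) = \<omega> i * Re z + Re (\<mu> i)" by simp
      ultimately have "Re (of_real (\<omega> i) * z + \<mu> i) \<in> J"
        unfolding J_def atLeastAtMost_iff using Re_mu[OF i] by linarith
      then have "Gamma (Re (of_real (\<omega> i) * z + \<mu> i)) \<le> B"
        using B by force
      then show "norm (Gamma (of_real (\<omega> i) * z + \<mu> i)) \<le> B"
        using norm_Gamma_le_Gamma_Re[OF Re_Gamma_arg_pos[OF i pos]] by linarith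
    qed
  qed
  moreover have "xi z = \<alpha> * z ^ m * of_real Q powr z * (\<Prod>i<k. Gamma (of_real (\<omega> i) * z + \<mu> i)) * G z" if "z \<in> S" for z
  proof -
    have z: "0 < Re z" "z \<noteq> 1" using that by (auto simp: S_def)
    show ?thesis unfolding xi_eq[OF z] G(2)[OF z(2)] gamma_fac_def by (simp only: mult_ac)
  qed
  ultimately show ?thesis unfolding exp_poly_growth_def by simp
qed

lemma xi_growth:
  shows "exp_poly_growth {z. 1 - c \<le> Re z \<and> Re z \<le> c \<and> 1 \<le> \<bar>Im z\<bar>} xi"
proof -
  obtain D N where D: "\<And>z. \<lbrakk>1 / 2 \<le> Re z; Re z \<le> c; 1 \<le> \<bar>Im z\<bar>\<rbrakk> \<Longrightarrow> norm (xi z) \<le> exp (D * (1 + \<bar>Im z\<bar>) ^ N)"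
    using xi_growth_right[of c] unfolding exp_poly_growth_def by blast
  show ?thesis
  proof (rule exp_poly_growthI)
    fix z assume "z \<in> {z. 1 - c \<le> Re z \<and> Re z \<le> c \<and> 1 \<le> \<bar>Im z\<bar>}"
    then show "norm (xi z) \<le> exp (D * (1 + \<bar>Im z\<bar>) ^ N)"
      using D[of z] D[of "1 - cnj z"] norm_xi_reflect[of z] by (cases "1 / 2 \<le> Re z") auto
  qed
qed

text \<open>Only the Gamma factor with index 0, present because k >= 1, is used for decay; the
  others are bounded by their values at the real parts.\<close>

lemma xi_edge:
  assumes c: "2 \<le> c"
  obtains B where "0 < B" "\<And>z. Re z = c \<Longrightarrow> norm (xi z * (z + of_real c)\<^sup>2) \<le> B"
proof -
  obtain M where M: "0 < M" "\<And>s. 2 \<le> Re s \<Longrightarrow> norm (F s) \<le> M" by (rule F_bounded) (rule that)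
  define w where "w = \<omega> 0"
  define u where "u = \<mu> 0"
  have w: "0 < w" and u: "0 \<le> Re u" using omega_pos[OF k_pos] Re_mu[OF k_pos] by (auto simp: w_def u_def)
  \<comment> \<open>Chosen so that norm (z + c) <= \<kappa> norm z0 for z0 = w z + u: here w norm z
    <= norm z0 + norm u, w c <= norm z0, and norm u <= norm u * norm z0 / w.\<close>
  define \<kappa> where "\<kappa> = 2 / w + norm u / w\<^sup>2"
  define P where "P = (\<Prod>i\<in>{..<k} - {0}. Gamma (\<omega> i * c + Re (\<mu> i)))"
  \<comment> \<open>One power for each factor of z^m, (z - 1)^m and (z + c)^2.\<close>
  define N where "N = m + m + 2"
  define B where "B = norm \<alpha> * Q powr c * M * P * \<kappa> ^ N * Gamma (w * c + Re u + real N)"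
  have gpos: "0 < \<omega> i * c + Re (\<mu> i)" if "i < k" for i
    using omega_pos[OF that] Re_mu[OF that] c by (intro add_pos_nonneg mult_pos_pos) auto
  have P: "0 \<le> P" unfolding P_def using gpos by (intro prod_nonneg) auto
  have main: "norm (xi z * (z + of_real c)\<^sup>2) \<le> B" if z: "Re z = c" for z
  proof -
    define z0 where "z0 = of_real w * z + u"
    have Rz0: "Re z0 = w * c + Re u" using z by (simp add: z0_def)
    have z0pos: "0 < Re z0" unfolding Rz0 using w c u by (intro add_pos_nonneg mult_pos_pos) auto
    have wc: "w * c \<le> norm z0" using complex_Re_le_cmod[of z0] Rz0 u by linarith
    have "w * norm z \<le> norm z0 + norm u"
    proof -
      have "norm (of_real w * z) = norm (z0 - u)" by (simp add: z0_def)
      then show ?thesis using norm_triangle_ineq4[of z0 u] w by (simp add: norm_mult)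
    qed
    moreover have "norm u \<le> norm u * (norm z0 / w)"
    proof -
      have "w * 1 \<le> w * c" using w c by (intro mult_left_mono) auto
      then have "w \<le> norm z0" using wc by linarith
      then have "1 \<le> norm z0 / w" using w by simp
      then show ?thesis using mult_left_mono[of 1 "norm z0 / w" "norm u"] by simp
    qed
    moreover have "w * norm (z + of_real c) \<le> w * norm z + w * c"
    proof -
      have "norm (z + of_real c) \<le> norm z + c" using norm_triangle_ineq[of z "of_real c"] c by simp
      then show ?thesis using w by (simp add: distrib_left [symmetric])
    qed
    ultimately have "w * norm (z + of_real c) \<le> 2 * norm z0 + norm u * (norm z0 / w)"
      using wc by linarith
    also have "\<dots> = w * (\<kappa> * norm z0)" using w by (simp add: \<kappa>_def field_simps power2_eq_square)
    finally have zc: "norm (z + of_real c) \<le> \<kappa> * norm z0" using w by simp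
    \<comment> \<open>With these, every polynomial factor is dominated by a power of norm (z +
      c).\<close>
    have n1: "norm z \<le> norm (z + of_real c)" and n2: "norm (z - 1) \<le> norm (z + of_real c)"
    proof -
      have "(Re z)\<^sup>2 \<le> (Re (z + of_real c))\<^sup>2" "(Re (z - 1))\<^sup>2 \<le> (Re (z + of_real c))\<^sup>2"
        by (rule power_mono; use z c in simp)+
      then show "norm z \<le> norm (z + of_real c)" "norm (z - 1) \<le> norm (z + of_real c)"
        unfolding cmod_def by simp_all
    qed
    have pos: "0 < Re z" "z \<noteq> 1" using z c by auto
    have prod: "norm (\<Prod>i<k. Gamma (of_real (\<omega> i) * z + \<mu> i)) \<le> norm (Gamma z0) * P"
    proof -
      have "(\<Prod>i<k. Gamma (of_real (\<omega> i) * z + \<mu> i)) = Gamma z0 * (\<Prod>i\<in>{..<k} - {0}. Gamma (of_real (\<omega> i) * z + \<mu> i))"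
        using k_pos by (subst prod.remove[of _ 0]) (auto simp: z0_def w_def u_def)
      moreover have "norm (\<Prod>i\<in>{..<k} - {0}. Gamma (of_real (\<omega> i) * z + \<mu> i)) \<le> P"
        unfolding P_def prod_norm [symmetric]
      proof (intro prod_mono conjI norm_ge_zero)
        fix i assume "i \<in> {..<k} - {0}"
        then show "norm (Gamma (of_real (\<omega> i) * z + \<mu> i)) \<le> Gamma (\<omega> i * c + Re (\<mu> i))"
          using norm_Gamma_le_Gamma_Re[OF Re_Gamma_arg_pos[of i z]] pos z by auto
      qed
      ultimately show ?thesis by (simp add: norm_mult mult_left_mono)
    qed
    define q where "q = norm (z + of_real c)"
    have "norm (\<gamma> z) = norm \<alpha> * norm z ^ m * norm (z - 1) ^ m * Q powr c * norm (\<Prod>i<k. Gamma (of_real (\<omega> i) * z + \<mu> i))"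
      unfolding gamma_fac_def using Q_pos z by (simp add: norm_mult norm_power norm_powr_real_powr)
    also have "\<dots> \<le> norm \<alpha> * q ^ m * q ^ m * Q powr c * (norm (Gamma z0) * P)"
      unfolding q_def using P by (intro mult_mono power_mono n1 n2 prod mult_nonneg_nonneg) auto
    finally have gam: "norm (\<gamma> z) \<le> norm \<alpha> * q ^ m * q ^ m * Q powr c * (norm (Gamma z0) * P)" .
    have "norm (xi z * (z + of_real c)\<^sup>2) = norm (\<gamma> z) * norm (F z) * q\<^sup>2"
      unfolding xi_eq[OF pos] q_def by (simp add: norm_mult norm_power)
    also have "\<dots> \<le> norm \<alpha> * q ^ m * q ^ m * Q powr c * (norm (Gamma z0) * P) * M * q\<^sup>2"
      using z c P M(1) M(2)[of z] by (intro mult_mono gam) (auto simp: q_def)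
    also have "\<dots> = norm \<alpha> * Q powr c * M * q ^ N * (norm (Gamma z0) * P)"
      by (simp add: N_def power_add power2_eq_square mult_ac)
    also have "\<dots> \<le> norm \<alpha> * Q powr c * M * (\<kappa> * norm z0) ^ N * (norm (Gamma z0) * P)"
      unfolding q_def using M(1) P by (intro mult_right_mono mult_left_mono power_mono zc) auto
    also have "\<dots> = norm \<alpha> * Q powr c * M * P * \<kappa> ^ N * (norm (Gamma z0) * norm z0 ^ N)"
      by (simp only: power_mult_distrib mult_ac)
    also have "\<dots> \<le> B"
      unfolding B_def using norm_Gamma_decay[OF z0pos, of N] M(1) P w
      by (intro mult_left_mono) (auto simp: Rz0 \<kappa>_def)
    finally show ?thesis .
  qed
  show ?thesis
  proof (rule that[of "B + 1"])
    have "0 \<le> B" using order_trans[OF norm_ge_zero main[of "of_real c"]] by simp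
    then show "0 < B + 1" by simp
    show "norm (xi z * (z + of_real c)\<^sup>2) \<le> B + 1" if "Re z = c" for z
      using main[OF that] by linarith
  qed
qed

lemma xi_decay:
  assumes c: "2 \<le> c"
  obtains B where "0 < B" "\<And>z. 1 - c \<le> Re z \<Longrightarrow> Re z \<le> c \<Longrightarrow> norm (xi z) \<le> B / (1 + (Im z)\<^sup>2)"
proof -
  obtain B where B: "0 < B" "\<And>z. Re z = c \<Longrightarrow> norm (xi z * (z + of_real c)\<^sup>2) \<le> B"
    by (rule xi_edge[OF c]) (rule that)
  \<comment> \<open>\<open>1 \<le> Re (z + of_real c)\<close> in the strip, so a bound on \<open>H\<close> yields quadratic decay of \<open>xi\<close>.\<close>
  define H where "H = (\<lambda>z. xi z * (z + of_real c)\<^sup>2)"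
  have "exp_poly_growth {z. 1 - c \<le> Re z \<and> Re z \<le> c \<and> 1 \<le> \<bar>Im z\<bar>} H"
    unfolding H_def using c
    by (intro exp_poly_growth_mult exp_poly_growth_power exp_poly_growth_linear[of _ c] xi_growth) auto
  then obtain D N where D: "\<And>z. \<lbrakk>1 - c \<le> Re z; Re z \<le> c; 1 \<le> \<bar>Im z\<bar>\<rbrakk> \<Longrightarrow> norm (H z) \<le> exp (D * (1 + \<bar>Im z\<bar>) ^ N)"
    unfolding exp_poly_growth_def by blast
  have H: "norm (H z) \<le> B" if "1 - c \<le> Re z" "Re z \<le> c" for z
  proof (rule phragmen_lindelof_strip[OF _ B(1) _ D that])
    show "H holomorphic_on UNIV" unfolding H_def by (intro holomorphic_intros xi_holomorphic)
    fix w assume w: "Re w = 1 - c \<or> Re w = c"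
    show "norm (H w) \<le> B"
    proof (cases "Re w = c")
      case False
      then have wc: "Re w = 1 - c" using w by simp
      \<comment> \<open>Reflecting from the left edge to the right edge preserves norm xi and the
        imaginary part, while Re (w + c) grows from 1 to 2 c.\<close>
      have "norm (w + of_real c) \<le> norm (1 - cnj w + of_real c)"
        unfolding cmod_def
      proof (intro real_sqrt_le_mono add_mono)
        show "(Re (w + of_real c))\<^sup>2 \<le> (Re (1 - cnj w + of_real c))\<^sup>2"
          by (rule power_mono) (use wc c in auto)
      qed simp
      then have "norm (H w) \<le> norm (H (1 - cnj w))"
        unfolding H_def norm_mult norm_power norm_xi_reflect by (intro mult_left_mono power_mono) auto
      also have "\<dots> \<le> B" unfolding H_def by (rule B(2)) (simp add: wc)
      finally show ?thesis .
    qed (simp add: H_def B(2))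
  qed
  show ?thesis
  proof (rule that[OF B(1)])
    fix z assume z: "1 - c \<le> Re z" "Re z \<le> c"
    have "1 + (Im z)\<^sup>2 \<le> (norm (z + of_real c))\<^sup>2"
      unfolding cmod_power2 using z by (simp add: one_le_power)
    then have "norm (xi z) * (1 + (Im z)\<^sup>2) \<le> norm (H z)"
      unfolding H_def norm_mult norm_power by (intro mult_left_mono) auto
    also have "\<dots> \<le> B" by (rule H[OF z])
    finally show "norm (xi z) \<le> B / (1 + (Im z)\<^sup>2)"
      by (subst pos_le_divide_eq) (auto simp: add_pos_nonneg)
  qed
qed

text \<open>The line is left free because it will be chosen in terms of s.\<close>

proposition xi_t_line_integral:
  assumes t: "t < 0" and c: "2 \<le> c"
  shows "xi_t xi t w = 1 / of_real (sqrt (pi * \<bar>t\<bar>)) *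
    (LINT v|lborel. xi (of_real c + \<i> * of_real v) * exp ((w - (of_real c + \<i> * of_real v))\<^sup>2 / of_real \<bar>t\<bar>))"
proof -
  define T where "T = \<bar>t\<bar>"
  have T: "0 < T" "t = - T" using t by (auto simp: T_def)
  obtain B where B: "0 < B" "\<And>z. 1 - c \<le> Re z \<Longrightarrow> Re z \<le> c \<Longrightarrow> norm (xi z) \<le> B / (1 + (Im z)\<^sup>2)"
    by (rule xi_decay[OF c]) (rule that)
  define f where "f = (\<lambda>z. xi z * exp ((w - z)\<^sup>2 / of_real T))"
  define g where "g = (\<lambda>x. xi ((1 + \<i> * of_real x) / 2))"
  define z where "z = - \<i> * (2 * w - 1)"
  have int: "integrable lborel g"
  proof (rule Bochner_Integration.integrable_bound[OF integrable_inverse_1_plus_square_real])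
    have "continuous_on UNIV g" unfolding g_def
      by (rule continuous_on_compose2[OF xi_continuous[of UNIV]]) (auto intro!: continuous_intros)
    then show "g \<in> borel_measurable lborel" by (simp add: borel_measurable_continuous_onI)
    show "AE x in lborel. norm (g x) \<le> norm (4 * B / (1 + x\<^sup>2))"
    proof (rule AE_I2)
      fix x :: real
      have "norm (g x) \<le> B / (1 + (x / 2)\<^sup>2)"
        unfolding g_def using B(2)[of "(1 + \<i> * of_real x) / 2"] c by simp
      also have "\<dots> \<le> B / ((1 + x\<^sup>2) / 4)"
        using B(1) by (intro divide_left_mono) (auto simp: power_divide add_pos_nonneg)
      finally show "norm (g x) \<le> norm (4 * B / (1 + x\<^sup>2))"
        using B(1) by (simp add: mult.commute)
    qed
  qed
  have "xi_t xi t w = (LINT u|lborel. 1 / (2 * of_real pi) * (of_real (exp (- T * u\<^sup>2)) * (LINT x|lborel. g x * exp (- \<i> * of_real x * of_real u)) * exp (\<i> * z * of_real u)))"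
  proof -
    have Phi: "Phi_F xi u = 1 / (2 * of_real pi) * (LINT x|lborel. g x * exp (- \<i> * of_real x * of_real u))" for u
      unfolding Phi_F_def g_def by simp
    show ?thesis unfolding xi_t_def Let_def z_def [symmetric] Phi T(2)
      by (intro Bochner_Integration.integral_cong refl) (simp only: mult_ac)
  qed
  also have "\<dots> = 1 / (2 * of_real pi) * (LINT u|lborel. of_real (exp (- T * u\<^sup>2)) * (LINT x|lborel. g x * exp (- \<i> * of_real x * of_real u)) * exp (\<i> * z * of_real u))"
    by (rule integral_mult_right_zero)
  also have "\<dots> = 1 / (2 * of_real pi) * (of_real (sqrt (pi / T)) * (LINT x|lborel. g x * exp (- (z - of_real x)\<^sup>2 / (4 * of_real T))))"
    by (simp only: integral_gaussian_convolution[OF int T(1)])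
  \<comment> \<open>The substitution x = 2 v turns (1 + i x) / 2 into 1/2 + i v and cancels the 4 in
    the exponent.\<close>
  also have "(LINT x|lborel. g x * exp (- (z - of_real x)\<^sup>2 / (4 * of_real T)))
     = \<bar>2\<bar> *\<^sub>R (LINT v|lborel. g (0 + 2 * v) * exp (- (z - of_real (0 + 2 * v))\<^sup>2 / (4 * of_real T)))"
    by (rule lborel_integral_real_affine) simp
  also have "(\<lambda>v. g (0 + 2 * v) * exp (- (z - of_real (0 + 2 * v))\<^sup>2 / (4 * of_real T))) = (\<lambda>v. f (of_real (1 / 2) + \<i> * of_real v))"
  proof
    fix v :: real
    have "z - of_real (0 + 2 * v) = - 2 * \<i> * (w - (of_real (1 / 2) + \<i> * of_real v))"
      by (simp add: z_def algebra_simps)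
    then have "- (z - of_real (0 + 2 * v))\<^sup>2 / (4 * of_real T) = (w - (of_real (1 / 2) + \<i> * of_real v))\<^sup>2 / of_real T"
      by (simp add: power_mult_distrib)
    moreover have "(1 + \<i> * of_real (0 + 2 * v)) / 2 = of_real (1 / 2) + \<i> * of_real v" by (simp add: field_simps)
    ultimately show "g (0 + 2 * v) * exp (- (z - of_real (0 + 2 * v))\<^sup>2 / (4 * of_real T)) = f (of_real (1 / 2) + \<i> * of_real v)"
      unfolding g_def f_def by (simp only:)
  qed
  also have "(LINT v|lborel. f (of_real (1 / 2) + \<i> * of_real v)) = (LINT v|lborel. f (of_real c + \<i> * of_real v))"
  proof (rule integral_vertical_line_shift)
    show "f holomorphic_on UNIV" unfolding f_def using T by (intro holomorphic_intros xi_holomorphic) auto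
    show "1 / 2 \<le> c" using c by simp
    fix s assume s: "1 / 2 \<le> Re s" "Re s \<le> c"
    \<comment> \<open>In the strip the Gaussian factor is bounded, because Re ((w - s)^2) is at most
      (Re w - Re s)^2; the decay comes from \<open>xi\<close>.\<close>
    define B' where "B' = B * exp ((\<bar>Re w\<bar> + c)\<^sup>2 / T)"
    have "Re ((w - s)\<^sup>2) \<le> (\<bar>Re w\<bar> + c)\<^sup>2"
    proof -
      have "Re ((w - s)\<^sup>2) = (Re w - Re s)\<^sup>2 - (Im w - Im s)\<^sup>2" by (simp add: power2_eq_square)
      also have "\<dots> \<le> (Re w - Re s)\<^sup>2" by simp
      also have "\<dots> \<le> (\<bar>Re w\<bar> + c)\<^sup>2"
        using s by (intro iffD1[OF abs_le_square_iff]) linarith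
      finally show ?thesis .
    qed
    then have "norm (exp ((w - s)\<^sup>2 / of_real T)) \<le> exp ((\<bar>Re w\<bar> + c)\<^sup>2 / T)"
      using T by (simp add: divide_right_mono)
    moreover have "norm (xi s) \<le> B / (1 + (Im s)\<^sup>2)" using s c by (intro B(2)) auto
    ultimately have "norm (f s) \<le> B / (1 + (Im s)\<^sup>2) * exp ((\<bar>Re w\<bar> + c)\<^sup>2 / T)"
      unfolding f_def norm_mult using B(1) by (intro mult_mono) auto
    then show "norm (f s) \<le> B' / (1 + (Im s)\<^sup>2)" by (simp add: B'_def)
  qed
  also have "1 / (2 * complex_of_real pi) * (of_real (sqrt (pi / T)) * \<bar>2\<bar> *\<^sub>R (LINT v|lborel. f (of_real c + \<i> * of_real v)))
     = of_real (sqrt (pi / T) / pi) * (LINT v|lborel. f (of_real c + \<i> * of_real v))"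
    by (simp add: scaleR_conv_of_real)
  also have "sqrt (pi / T) / pi = 1 / sqrt (pi * T)"
  proof -
    have "sqrt pi * sqrt pi = pi" by simp
    then show ?thesis using T by (simp add: real_sqrt_divide real_sqrt_mult field_simps del: real_sqrt_mult_self)
  qed
  finally show ?thesis unfolding f_def T_def by simp
qed

end

section \<open>Main term and gamma-factor ratio\<close>

text \<open>With L = ln n the first factor is n^(-h) on the line Re h = d. The value does not depend
  on d, and exp (- (T / 4) L^2) is the weight of the n-th term in \<open>F_t\<close>.\<close>

lemma integral_shifted_gaussian:
  fixes d L T :: real
  assumes T: "0 < T"
  defines "f \<equiv> (\<lambda>v. exp (- ((of_real d + \<i> * of_real v) * of_real L)) * exp ((of_real d + \<i> * of_real v)\<^sup>2 / of_real T))"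
  shows "integrable lborel f" and "(LINT v|lborel. f v) = of_real (sqrt (pi * T) * exp (- (T / 4) * L\<^sup>2))"
proof -
  define b where "b = \<i> * of_real (2 * d / T - L)"
  define e where "e = exp (of_real (d\<^sup>2 / T - d * L) :: complex)"
  have aT: "0 < 1 / T" using T by simp
  have f: "f = (\<lambda>v. e * exp (- of_real (1 / T * v\<^sup>2) + b * of_real v))"
    unfolding f_def b_def e_def exp_add [symmetric] using T
    by (intro ext arg_cong[where f = exp]) (simp add: power2_eq_square field_simps)
  show "integrable lborel f"
    unfolding f by (intro integrable_mult_right integrable_complex_gaussian[OF aT])
  have "(LINT v|lborel. f v) = e * (of_real (sqrt (pi / (1 / T))) * exp (b\<^sup>2 / (4 * of_real (1 / T))))"
    unfolding f by (simp only: integral_mult_right_zero integral_complex_gaussian[OF aT])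
  also have "b\<^sup>2 / (4 * of_real (1 / T)) = of_real (- (T / 4) * L\<^sup>2) - of_real (d\<^sup>2 / T - d * L)"
    unfolding b_def using T by (simp add: power_mult_distrib power2_eq_square field_simps)
  also have "e * (of_real (sqrt (pi / (1 / T))) * exp (of_real (- (T / 4) * L\<^sup>2) - of_real (d\<^sup>2 / T - d * L)))
     = of_real (sqrt (pi * T)) * exp (of_real (- (T / 4) * L\<^sup>2))"
    unfolding e_def by (simp add: exp_diff)
  finally show "(LINT v|lborel. f v) = of_real (sqrt (pi * T) * exp (- (T / 4) * L\<^sup>2))"
    by (simp only: of_real_mult[of "sqrt (pi * T)"] exp_of_real)
qed

lemma norm_exp_gaussian:
  "norm (exp ((of_real d + \<i> * of_real v)\<^sup>2 / of_real T)) = exp (d\<^sup>2 / T) * exp (- (v\<^sup>2 / T))"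
  by (simp add: exp_add [symmetric] power2_eq_square diff_divide_distrib)

lemma real_gaussian:
  fixes T :: real
  assumes "0 < T"
  shows "integrable lborel (\<lambda>v. exp (- (v\<^sup>2 / T)))" and "(LINT v|lborel. exp (- (v\<^sup>2 / T))) = sqrt (pi * T)"
proof -
  have "complex_of_real (exp (- (v\<^sup>2 / T))) = exp (- ((of_real 0 + \<i> * of_real v) * of_real 0)) * exp ((of_real 0 + \<i> * of_real v)\<^sup>2 / of_real T)" for v
    by (simp add: exp_of_real [symmetric] power_mult_distrib)
  then have i: "integrable lborel (\<lambda>v. complex_of_real (exp (- (v\<^sup>2 / T))))"
    and e: "(LINT v|lborel. complex_of_real (exp (- (v\<^sup>2 / T)))) = of_real (sqrt (pi * T))"
    using integral_shifted_gaussian[OF assms, of 0 0] by simp_all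
  show "integrable lborel (\<lambda>v. exp (- (v\<^sup>2 / T)))"
    using i by (simp only: complex_of_real_integrable_eq)
  show "(LINT v|lborel. exp (- (v\<^sup>2 / T))) = sqrt (pi * T)"
    using e by (simp only: integral_complex_of_real of_real_eq_iff)
qed

text \<open>The bound \<open>exp b - 1\<close> is chosen so that it is multiplicative: the exponents add.\<close>
definition near_one :: "real \<Rightarrow> complex \<Rightarrow> bool" where
  "near_one b f \<longleftrightarrow> 0 \<le> b \<and> norm (f - 1) \<le> exp b - 1"

lemma near_one_mult:
  assumes "near_one b f" "near_one c g"
  shows "near_one (b + c) (f * g)"
proof -
  have "f * g - 1 = (f - 1) * (g - 1) + (f - 1) + (g - 1)" by (simp add: algebra_simps)
  then have "norm (f * g - 1) \<le> norm (f - 1) * norm (g - 1) + norm (f - 1) + norm (g - 1)"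
    by (metis norm_mult norm_triangle_le add_mono order_refl norm_triangle_ineq)
  also have "\<dots> \<le> (exp b - 1) * (exp c - 1) + (exp b - 1) + (exp c - 1)"
    using assms unfolding near_one_def by (intro add_mono mult_mono) auto
  also have "\<dots> = exp (b + c) - 1" by (simp add: exp_add algebra_simps)
  finally show ?thesis using assms by (simp add: near_one_def)
qed

lemma near_one_power:
  assumes "near_one b f"
  shows "near_one (real n * b) (f ^ n)"
proof (induction n)
  case (Suc n)
  show ?case using near_one_mult[OF assms Suc] by (simp add: algebra_simps)
qed (simp add: near_one_def)

lemma near_one_prod:
  assumes "finite I" "\<And>i. i \<in> I \<Longrightarrow> near_one (b i) (f i)"
  shows "near_one (\<Sum>i\<in>I. b i) (\<Prod>i\<in>I. f i)"
  using assms by (induction I rule: finite_induct) (auto intro: near_one_mult simp: near_one_def [of 0])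

lemma near_one_mono: "near_one b f \<Longrightarrow> b \<le> c \<Longrightarrow> near_one c f"
  unfolding near_one_def by (smt (verit) exp_le_cancel_iff)

text \<open>Termwise comparison of the exponential series without their constant terms.\<close>

lemma near_one_exp: "near_one (norm g) (exp g)"
proof -
  have "(\<lambda>n. g ^ Suc n /\<^sub>R fact (Suc n)) sums (exp g - 1)"
    using exp_converges[of g] by (subst sums_Suc_iff) simp
  moreover have r: "(\<lambda>n. norm g ^ Suc n /\<^sub>R fact (Suc n)) sums (exp (norm g) - 1)"
    using exp_converges[of "norm g"] by (subst sums_Suc_iff) simp
  moreover have "norm (\<Sum>n. g ^ Suc n /\<^sub>R fact (Suc n)) \<le> (\<Sum>n. norm g ^ Suc n /\<^sub>R fact (Suc n))"
  proof (rule norm_suminf_le)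
    show "summable (\<lambda>n. norm g ^ Suc n /\<^sub>R fact (Suc n))" using r by (rule sums_summable)
    show "norm (g ^ Suc n /\<^sub>R fact (Suc n)) \<le> norm g ^ Suc n /\<^sub>R fact (Suc n)" for n
      by (simp add: norm_mult norm_power abs_mult del: fact_Suc)
  qed
  ultimately have "norm (exp g - 1) \<le> exp (norm g) - 1"
    by (simp only: sums_iff)
  then show ?thesis by (simp add: near_one_def)
qed

lemma near_one_plus:
  assumes "norm z \<le> b"
  shows "near_one b (1 + z)"
proof -
  have "0 \<le> b" using assms norm_ge_zero order_trans by blast
  moreover have "norm z \<le> exp b - 1" using assms exp_ge_add_one_self[of b] by linarith
  ultimately show ?thesis by (simp add: near_one_def)
qed

context extended_selberg
begin

text \<open>\<open>\<Lambda>\<close> is the leading term of the logarithmic derivative of the gamma factor.\<close>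
definition \<Lambda> :: "complex \<Rightarrow> complex" where
  "\<Lambda> s = of_real (ln Q) + (\<Sum>i<k. of_real (\<omega> i) * Ln (of_real (\<omega> i) * s))"

lemma J_t_eq: "J_t Q k \<omega> t s = s + of_real (\<bar>t\<bar> / 2) * \<Lambda> s"
  by (simp add: J_t_def \<Lambda>_def distrib_left)

text \<open>On a line with Re (s + h) >= 2 the n-th term is at most |a_n| / n^2 times one fixed
  Gaussian, which justifies integrating the Dirichlet series term by term.\<close>

lemma F_t_integral:
  assumes t: "t < 0" and d: "2 \<le> Re s + d"
  shows "integrable lborel (\<lambda>v. F (s + (of_real d + \<i> * of_real v)) * exp ((of_real d + \<i> * of_real v)\<^sup>2 / of_real \<bar>t\<bar>))" (is ?int)
    and "(LINT v|lborel. F (s + (of_real d + \<i> * of_real v)) * exp ((of_real d + \<i> * of_real v)\<^sup>2 / of_real \<bar>t\<bar>))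
           = of_real (sqrt (pi * \<bar>t\<bar>)) * F_t a t s" (is ?eq)
proof -
  define T where "T = \<bar>t\<bar>"
  have T: "0 < T" using t by (simp add: T_def)
  define h where "h = (\<lambda>v. of_real d + \<i> * complex_of_real v)"
  define f where "f = (\<lambda>n v. a (Suc n) / of_nat (Suc n) powr (s + h v) * exp ((h v)\<^sup>2 / of_real T))"
  define A where "A = (\<lambda>n. norm (a (Suc n) / of_nat (Suc n) powr 2))"
  define E where "E = (\<lambda>v. exp (d\<^sup>2 / T) * exp (- (v\<^sup>2 / T)))"
  define l where "l = (\<lambda>n. ln (real (Suc n)))"
  have A: "summable A" unfolding A_def by (rule dirichlet_summable) simp
  have f_alt: "f n v = a (Suc n) / of_nat (Suc n) powr s * (exp (- (h v * of_real (l n))) * exp ((h v)\<^sup>2 / of_real T))" for n v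
  proof -
    have L: "Ln (of_nat (Suc n)) = of_real (l n)" unfolding l_def by (rule Ln_of_nat) simp
    have "(of_nat (Suc n) :: complex) \<noteq> 0" by (simp del: of_nat_Suc)
    then have "a (Suc n) / of_nat (Suc n) powr (s + h v) = a (Suc n) / of_nat (Suc n) powr s * exp (- (h v * of_real (l n)))"
      unfolding powr_add by (simp add: powr_def L exp_minus divide_inverse del: of_nat_Suc)
    then show ?thesis unfolding f_def by simp
  qed
  have int: "integrable lborel (f n)" for n
    unfolding f_alt h_def by (intro integrable_mult_right integral_shifted_gaussian(1)[OF T])
  have val: "(LINT v|lborel. f n v) = of_real (sqrt (pi * T)) * (of_real (exp (- (\<bar>t\<bar> / 4) * (ln (real (Suc n)))\<^sup>2)) * a (Suc n) / of_nat (Suc n) powr s)" for n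
  proof -
    have "(LINT v|lborel. f n v) = a (Suc n) / of_nat (Suc n) powr s * of_real (sqrt (pi * T) * exp (- (T / 4) * (l n)\<^sup>2))"
      unfolding f_alt h_def integral_mult_right_zero integral_shifted_gaussian(2)[OF T] ..
    then show ?thesis
      unfolding T_def [symmetric] of_real_mult[of "sqrt (pi * T)"] by (simp add: l_def)
  qed
  have Re_h: "2 \<le> Re (s + h v)" for v using d by (simp add: h_def)
  have norm_f: "norm (f n v) \<le> A n * E v" for n v
    unfolding f_def norm_mult A_def E_def norm_exp_gaussian [symmetric] h_def
    by (intro mult_right_mono norm_dirichlet_term_le) (use d in auto)
  have E: "integrable lborel E" unfolding E_def by (intro integrable_mult_right real_gaussian(1) T)
  have Epos: "0 \<le> E v" for v by (simp add: E_def)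
  have sum_f: "summable (\<lambda>n. norm (f n v))" for v
    by (rule summable_comparison_test'[OF summable_mult2[OF A, of "E v"]]) (simp add: norm_f)
  have sum_int: "summable (\<lambda>n. LINT v|lborel. norm (f n v))"
  proof (rule summable_comparison_test'[OF summable_mult2[OF A, of "LINT v|lborel. E v"]])
    fix n :: nat
    have "(LINT v|lborel. norm (f n v)) \<le> (LINT v|lborel. A n * E v)"
      by (intro integral_mono integrable_norm int integrable_mult_right E norm_f)
    then show "norm (LINT v|lborel. norm (f n v)) \<le> A n * (LINT v|lborel. E v)"
      by simp
  qed
  have Ff: "(\<Sum>n. f n v) = F (s + h v) * exp ((h v)\<^sup>2 / of_real T)" for v
  proof -
    have Re_gt: "1 < Re (s + h v)" using Re_h[of v] by linarith
    show ?thesis unfolding f_def F_dirichlet[OF Re_gt]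
      by (rule suminf_mult2 [symmetric], rule summable_norm_cancel, rule dirichlet_summable[OF Re_gt])
  qed
  have "integrable lborel (\<lambda>v. \<Sum>n. f n v)"
    by (rule integrable_suminf) (use int sum_f sum_int in auto)
  then show ?int unfolding Ff h_def T_def .
  have "(LINT v|lborel. (\<Sum>n. f n v)) = (\<Sum>n. (LINT v|lborel. f n v))"
    by (rule integral_suminf) (use int sum_f sum_int in auto)
  also have "\<dots> = of_real (sqrt (pi * T)) * F_t a t s"
  proof -
    have "summable (\<lambda>n. LINT v|lborel. f n v)"
      by (rule summable_integral) (use int sum_f sum_int in auto)
    \<comment> \<open>Convergence of the series defining \<open>F_t\<close> is inherited from the
      series of integrals.\<close>
    then have "summable (\<lambda>n. 1 / of_real (sqrt (pi * T)) * (LINT v|lborel. f n v))" by (rule summable_mult)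
    then have "summable (\<lambda>n. of_real (exp (- (\<bar>t\<bar> / 4) * (ln (real (Suc n)))\<^sup>2)) * a (Suc n) / of_nat (Suc n) powr s)"
      unfolding val using T by simp
    then show ?thesis unfolding val F_t_def by (rule suminf_mult)
  qed
  finally show ?eq unfolding Ff h_def T_def .
qed

text \<open>The factor exp (- \<Lambda> s h) cancels Q^h and the main exponential of each Gamma
  ratio. What remains is (1 + h/s)^m (1 + h/(s - 1))^m times the error exponentials, all of them
  \<open>near_one\<close>.\<close>

proposition gamma_fac_shift:
  obtains K Y where "0 < K" "0 < Y"
    "\<And>(s :: complex) (h :: complex). \<lbrakk>Y \<le> Im s; \<bar>Re s\<bar> \<le> Im s / 8; 0 \<le> Re h; 2 \<le> Re (s + h)\<rbrakk> \<Longrightarrow>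
       \<gamma> s \<noteq> 0 \<and> norm (\<gamma> (s + h) / \<gamma> s * exp (- (\<Lambda> s * h)) - 1) \<le> exp (K * (1 + (norm h)\<^sup>2) / sqrt (Im s)) - 1"
proof -
  \<comment> \<open>Moving i < k inside the existential statement lets choice produce total
    functions of i.\<close>
  have "\<forall>i. \<exists>K Y. i < k \<longrightarrow> 0 < K \<and> 0 < Y \<and> (\<forall>s h. Y \<le> Im s \<and> \<bar>Re s\<bar> \<le> Im s / 8 \<and> 0 \<le> Re h \<and> 2 \<le> Re (s + h) \<longrightarrow>
       Gamma (of_real (\<omega> i) * s + \<mu> i) \<noteq> 0 \<and>
       (\<exists>g :: complex. Gamma (of_real (\<omega> i) * (s + h) + \<mu> i) = Gamma (of_real (\<omega> i) * s + \<mu> i) * exp (of_real (\<omega> i) * h * Ln (of_real (\<omega> i) * s) + g) \<and>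
            norm g \<le> K * (1 + (norm h)\<^sup>2) / sqrt (Im s)))"
  proof (intro allI)
    fix i
    show "\<exists>K Y. i < k \<longrightarrow> 0 < K \<and> 0 < Y \<and> (\<forall>s h. Y \<le> Im s \<and> \<bar>Re s\<bar> \<le> Im s / 8 \<and> 0 \<le> Re h \<and> 2 \<le> Re (s + h) \<longrightarrow>
       Gamma (of_real (\<omega> i) * s + \<mu> i) \<noteq> 0 \<and>
       (\<exists>g :: complex. Gamma (of_real (\<omega> i) * (s + h) + \<mu> i) = Gamma (of_real (\<omega> i) * s + \<mu> i) * exp (of_real (\<omega> i) * h * Ln (of_real (\<omega> i) * s) + g) \<and>
            norm g \<le> K * (1 + (norm h)\<^sup>2) / sqrt (Im s)))"
    proof (cases "i < k")
      case True
      show ?thesis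
        by (rule Gamma_shift_asymptotics[OF omega_pos[OF True] Re_mu[OF True]]) blast
    qed simp
  qed
  then obtain KK YY where KY: "\<And>i. i < k \<Longrightarrow> 0 < KK i" "\<And>i. i < k \<Longrightarrow> 0 < YY i"
     "\<And>i s h. \<lbrakk>i < k; YY i \<le> Im s; \<bar>Re s\<bar> \<le> Im s / 8; 0 \<le> Re h; 2 \<le> Re (s + h)\<rbrakk> \<Longrightarrow>
       Gamma (of_real (\<omega> i) * s + \<mu> i) \<noteq> 0 \<and>
       (\<exists>g :: complex. Gamma (of_real (\<omega> i) * (s + h) + \<mu> i) = Gamma (of_real (\<omega> i) * s + \<mu> i) * exp (of_real (\<omega> i) * h * Ln (of_real (\<omega> i) * s) + g) \<and>
            norm g \<le> KK i * (1 + (norm h)\<^sup>2) / sqrt (Im s))"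
    unfolding choice_iff by blast
  \<comment> \<open>The term 2 m pays for the two polynomial factors; the added 1 gives positivity
    directly.\<close>
  define K where "K = (\<Sum>i<k. KK i) + 2 * real m + 1"
  define Y where "Y = (\<Sum>i<k. YY i) + 1"
  have "0 \<le> (\<Sum>i<k. KK i)" "0 \<le> (\<Sum>i<k. YY i)" using KY(1,2) by (auto intro!: sum_nonneg simp: less_imp_le)
  then have pos: "0 < K" "1 \<le> Y" by (auto simp: K_def Y_def)
  show ?thesis
  proof (rule that[OF pos(1)])
    fix s h :: complex
    assume y: "Y \<le> Im s" and s: "\<bar>Re s\<bar> \<le> Im s / 8" and h: "0 \<le> Re h" "2 \<le> Re (s + h)"
    define y where "y = Im s"
    have y1: "1 \<le> y" using y pos by (simp add: y_def)
    have YYi: "YY i \<le> Im s" if "i < k" for i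
      using member_le_sum[of i "{..<k}" YY] KY(2) that y by (auto simp: Y_def less_imp_le)
    have "\<forall>i. \<exists>g. i < k \<longrightarrow> Gamma (of_real (\<omega> i) * (s + h) + \<mu> i) = Gamma (of_real (\<omega> i) * s + \<mu> i) * exp (of_real (\<omega> i) * h * Ln (of_real (\<omega> i) * s) + g) \<and>
            norm g \<le> KK i * (1 + (norm h)\<^sup>2) / sqrt (Im s)"
      using KY(3)[OF _ YYi s h] by blast
    then obtain g where g: "\<And>i. i < k \<Longrightarrow> Gamma (of_real (\<omega> i) * (s + h) + \<mu> i) = Gamma (of_real (\<omega> i) * s + \<mu> i) * exp (of_real (\<omega> i) * h * Ln (of_real (\<omega> i) * s) + g i)"
       "\<And>i. i < k \<Longrightarrow> norm (g i) \<le> KK i * (1 + (norm h)\<^sup>2) / sqrt y"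
      unfolding choice_iff y_def by blast
    have G0: "\<And>i. i < k \<Longrightarrow> Gamma (of_real (\<omega> i) * s + \<mu> i) \<noteq> 0" using KY(3)[OF _ YYi s h] by blast
    have s0: "s \<noteq> 0" "s \<noteq> 1" using y1 by (auto simp: y_def)
    have gs: "\<gamma> s \<noteq> 0"
      unfolding gamma_fac_def using alpha_nonzero s0 Q_pos G0 by auto
    have Qh: "of_real Q powr (s + h) = of_real Q powr s * exp (h * of_real (ln Q))"
      using Q_pos by (simp add: powr_def Ln_of_real distrib_right exp_add)
    have prod: "(\<Prod>i<k. Gamma (of_real (\<omega> i) * (s + h) + \<mu> i)) = (\<Prod>i<k. Gamma (of_real (\<omega> i) * s + \<mu> i)) * exp (h * (\<Sum>i<k. of_real (\<omega> i) * Ln (of_real (\<omega> i) * s))) * (\<Prod>i<k. exp (g i))"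
    proof -
      have "(\<Prod>i<k. Gamma (of_real (\<omega> i) * (s + h) + \<mu> i)) = (\<Prod>i<k. Gamma (of_real (\<omega> i) * s + \<mu> i) * exp (h * (of_real (\<omega> i) * Ln (of_real (\<omega> i) * s))) * exp (g i))"
      proof (rule prod.cong[OF refl])
        fix i assume "i \<in> {..<k}"
        then show "Gamma (of_real (\<omega> i) * (s + h) + \<mu> i) = Gamma (of_real (\<omega> i) * s + \<mu> i) * exp (h * (of_real (\<omega> i) * Ln (of_real (\<omega> i) * s))) * exp (g i)"
          using g(1)[of i] by (simp only: lessThan_iff exp_add mult_ac)
      qed
      then show ?thesis by (simp add: prod.distrib exp_sum sum_distrib_left)
    qed
    have eL: "exp (- (\<Lambda> s * h)) = 1 / (exp (h * of_real (ln Q)) * exp (h * (\<Sum>i<k. of_real (\<omega> i) * Ln (of_real (\<omega> i) * s))))"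
      unfolding \<Lambda>_def exp_minus exp_add [symmetric] by (simp add: algebra_simps divide_inverse)
    have "\<gamma> (s + h) / \<gamma> s * exp (- (\<Lambda> s * h)) = ((s + h) / s) ^ m * ((s + h - 1) / (s - 1)) ^ m * (\<Prod>i<k. exp (g i))"
      using gs unfolding eL gamma_fac_def Qh prod
      by (simp add: power_divide)
    also have "(s + h) / s = 1 + h / s" using s0 by (simp add: field_simps)
    also have "(s + h - 1) / (s - 1) = 1 + h / (s - 1)" using s0 by (simp add: field_simps)
    finally have eq: "\<gamma> (s + h) / \<gamma> s * exp (- (\<Lambda> s * h)) = (1 + h / s) ^ m * (1 + h / (s - 1)) ^ m * (\<Prod>i<k. exp (g i))" .
    define X where "X = (1 + (norm h)\<^sup>2) / sqrt y"
    have hX: "norm h / y \<le> X"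
      unfolding X_def using y1 le_one_plus_square[of "norm h"] sqrt_le_self[of y] by (intro frac_le) auto
    have n1: "near_one X (1 + h / s)"
    proof (rule near_one_plus)
      have "norm (h / s) \<le> norm h / y" unfolding norm_divide y_def
        using abs_Im_le_cmod[of s] y1 by (intro divide_left_mono) (auto simp: y_def s0)
      then show "norm (h / s) \<le> X" using hX by linarith
    qed
    have n2: "near_one X (1 + h / (s - 1))"
    proof (rule near_one_plus)
      have "norm (h / (s - 1)) \<le> norm h / y" unfolding norm_divide y_def
        using abs_Im_le_cmod[of "s - 1"] y1 by (intro divide_left_mono) (auto simp: y_def s0)
      then show "norm (h / (s - 1)) \<le> X" using hX by linarith
    qed
    have n3: "near_one (\<Sum>i<k. KK i * X) (\<Prod>i<k. exp (g i))"
      by (intro near_one_prod near_one_mono[OF near_one_exp]) (auto simp: X_def g(2))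
    have "near_one (real m * X + real m * X + (\<Sum>i<k. KK i * X)) (\<gamma> (s + h) / \<gamma> s * exp (- (\<Lambda> s * h)))"
      unfolding eq by (intro near_one_mult near_one_power n1 n2 n3)
    moreover have "real m * X + real m * X + (\<Sum>i<k. KK i * X) \<le> K * X"
      unfolding K_def sum_distrib_right [symmetric] using n1 by (simp add: near_one_def algebra_simps)
    ultimately have "near_one (K * X) (\<gamma> (s + h) / \<gamma> s * exp (- (\<Lambda> s * h)))"
      by (rule near_one_mono)
    then show "\<gamma> s \<noteq> 0 \<and> norm (\<gamma> (s + h) / \<gamma> s * exp (- (\<Lambda> s * h)) - 1) \<le> exp (K * (1 + (norm h)\<^sup>2) / sqrt (Im s)) - 1"
      using gs by (simp add: near_one_def X_def y_def)
  qed (use pos in auto)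
qed

end

section \<open>The error estimate\<close>

text \<open>Here u stands for (norm h)^2. In exp b - 1 <= b exp b, one factor e = exp (u / (4 C))
  dominates 1 + u and a second one dominates the growth of exp b. Their product exp (u / (2 C)) is
  at most exp (u / (2 T)), half of the available Gaussian.\<close>

lemma exp_minus_one_le_gaussian:
  fixes C T u \<epsilon> :: real
  assumes "0 < C" "0 < T" "T \<le> C" "0 \<le> u" "0 \<le> \<epsilon>" "\<epsilon> \<le> 1 / (4 * C)"
  shows "exp (\<epsilon> * (1 + u)) - 1 \<le> \<epsilon> * ((1 + 4 * C) * exp (1 / (4 * C))) * exp (u / (2 * T))"
proof -
  define b where "b = \<epsilon> * (1 + u)"
  define e where "e = exp (u / (4 * C))"
  have "0 \<le> u / (4 * C)" using assms by simp
  then have e: "1 \<le> e" "u / (4 * C) \<le> e"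
    using exp_ge_add_one_self[of "u / (4 * C)"] unfolding e_def by linarith+
  have "b \<ge> 1 - exp (- b)" using exp_ge_add_one_self[of "- b"] by simp
  then have "exp b * (1 - exp (- b)) \<le> exp b * b" by (intro mult_left_mono) auto
  then have "exp b - 1 \<le> b * exp b" by (simp add: right_diff_distrib exp_minus mult.commute)
  also have "b * exp b \<le> (\<epsilon> * ((1 + 4 * C) * e)) * (exp (1 / (4 * C)) * e)"
  proof (intro mult_mono)
    have "1 + u \<le> (1 + 4 * C) * e" using e assms(1) by (simp add: field_simps)
    then show "b \<le> \<epsilon> * ((1 + 4 * C) * e)" unfolding b_def using assms by (intro mult_left_mono) auto
    have "b \<le> 1 / (4 * C) * (1 + u)" unfolding b_def using assms by (intro mult_right_mono) auto
    also have "\<dots> = 1 / (4 * C) + u / (4 * C)" by (simp add: add_divide_distrib)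
    finally show "exp b \<le> exp (1 / (4 * C)) * e" by (simp add: e_def exp_add [symmetric])
  qed (use assms in \<open>auto simp: e_def\<close>)
  also have "\<dots> = \<epsilon> * ((1 + 4 * C) * exp (1 / (4 * C))) * (e * e)" by (simp only: mult_ac)
  also have "\<dots> \<le> \<epsilon> * ((1 + 4 * C) * exp (1 / (4 * C))) * exp (u / (2 * T))"
  proof (intro mult_left_mono)
    have "u / (2 * C) \<le> u / (2 * T)" using assms by (intro divide_left_mono) auto
    then show "e * e \<le> exp (u / (2 * T))" by (simp add: e_def exp_add [symmetric])
  qed (use assms in auto)
  finally show ?thesis by (simp add: b_def)
qed

text \<open>The gap is 0 for x >= 2, at most 4 for x between -2 and 2, and 2 - x <= - 2 x below -2.
  So its square is at most 4 (min x (-2))^2, and 3/2 * 4 = 6 <= 10.\<close>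

lemma max_gap_square_le:
  fixes x :: real
  shows "3 / 2 * (max x 2 - x)\<^sup>2 \<le> 10 * (min x (- 2))\<^sup>2"
proof -
  have "(max x 2 - x)\<^sup>2 \<le> (2 * min x (- 2))\<^sup>2"
    by (rule iffD1[OF abs_le_square_iff]) (auto simp: max_def min_def)
  then have "(max x 2 - x)\<^sup>2 \<le> 4 * (min x (- 2))\<^sup>2" by (simp add: power_mult_distrib)
  then show ?thesis using zero_le_power2[of "min x (- 2)"] by linarith
qed

context extended_selberg
begin

text \<open>Writing R f = f + (R - 1) f separates the exact main term from the error. The constant
  3/2 is 1 from the Gaussian at real part d plus 1/2 from \<open>exp_minus_one_le_gaussian\<close>;
  sqrt 2 is the ratio of the normalisations for 2 T and T.\<close>

lemma xi_t_error:
  fixes C K M t :: real and s :: complex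
  defines "d \<equiv> max (Re s) 2 - Re s" and "\<epsilon> \<equiv> K / sqrt (Im s)"
  assumes t: "t < 0" "\<bar>t\<bar> \<le> C" and C: "0 < C" and M: "0 < M" "\<And>w. 2 \<le> Re w \<Longrightarrow> norm (F w) \<le> M"
    and eps: "0 \<le> \<epsilon>" "\<epsilon> \<le> 1 / (4 * C)" and gs: "\<gamma> s \<noteq> 0"
    and shift: "\<And>h :: complex. 0 \<le> Re h \<Longrightarrow> 2 \<le> Re (s + h) \<Longrightarrow>
      norm (\<gamma> (s + h) / \<gamma> s * exp (- (\<Lambda> s * h)) - 1) \<le> exp (\<epsilon> * (1 + (norm h)\<^sup>2)) - 1"
  shows "\<exists>E. xi_t xi t (J_t Q k \<omega> t s) = gamma_t m \<alpha> Q k \<omega> \<mu> t s * (F_t a t s + E) \<and>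
     norm E \<le> sqrt 2 * (\<epsilon> * ((1 + 4 * C) * exp (1 / (4 * C))) * M * exp (3 / 2 * d\<^sup>2 / \<bar>t\<bar>))"
proof -
  define T where "T = \<bar>t\<bar>"
  have T: "0 < T" "T \<le> C" using t by (auto simp: T_def)
  have d: "0 \<le> d" "2 \<le> Re s + d" by (auto simp: d_def)
  define h where "h = (\<lambda>v. of_real d + \<i> * complex_of_real v)"
  define R where "R = (\<lambda>v. \<gamma> (s + h v) / \<gamma> s * exp (- (\<Lambda> s * h v)))"
  define f where "f = (\<lambda>v. F (s + h v) * exp ((h v)\<^sup>2 / of_real T))"
  define g where "g = (\<lambda>v. (R v - 1) * f v)"
  define J where "J = J_t Q k \<omega> t s"
  define G where "G = gamma_t m \<alpha> Q k \<omega> \<mu> t s"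
  define B where "B = \<epsilon> * ((1 + 4 * C) * exp (1 / (4 * C))) * M * exp (3 / 2 * d\<^sup>2 / T)"
  have h: "0 \<le> Re (h v)" "2 \<le> Re (s + h v)" "(norm (h v))\<^sup>2 = d\<^sup>2 + v\<^sup>2" for v
    using d by (auto simp: h_def cmod_power2)
  have fint: "integrable lborel f" and fval: "(LINT v|lborel. f v) = of_real (sqrt (pi * T)) * F_t a t s"
    unfolding f_def h_def T_def by (rule F_t_integral[OF t(1) d(2)])+
  have G0: "G \<noteq> 0" unfolding G_def gamma_t_def using gs by simp
  have key: "xi (s + h v) * exp ((J - (s + h v))\<^sup>2 / of_real T) = G * (R v * f v)" for v
  proof -
    define A where "A = of_real (T / 2) * \<Lambda> s"
    have J: "J = s + A" unfolding J_def A_def T_def by (rule J_t_eq)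
    have G: "G = \<gamma> s * exp (A\<^sup>2 / of_real T)"
      unfolding G_def gamma_t_def J_def [symmetric] J T_def by simp
    have "(J - (s + h v))\<^sup>2 / of_real T = A\<^sup>2 / of_real T + (- (\<Lambda> s * h v)) + (h v)\<^sup>2 / of_real T"
      unfolding J A_def using T by (simp add: power2_eq_square field_simps)
    moreover have "xi (s + h v) = \<gamma> (s + h v) * F (s + h v)"
    proof (rule xi_eq)
      have "1 < Re (s + h v)" using h(2)[of v] by linarith
      then show "0 < Re (s + h v)" "s + h v \<noteq> 1" by (linarith, metis less_irrefl one_complex.sel(1))
    qed
    moreover have "xi (s + h v) * (exp (A\<^sup>2 / of_real T) * exp (- (\<Lambda> s * h v)) * exp ((h v)\<^sup>2 / of_real T)) = G * (R v * f v)"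
      if "xi (s + h v) = \<gamma> (s + h v) * F (s + h v)"
      unfolding that G R_def f_def using gs by simp
    ultimately show ?thesis by (simp only: exp_add)
  qed
  \<comment> \<open>\<open>R\<close> contains Gamma factors, so measurability is obtained through
    \<open>key\<close> from the continuity of \<open>xi\<close>, dividing by the nonzero constant
    \<open>G\<close>.\<close>
  have gm: "g \<in> borel_measurable lborel"
  proof -
    have "continuous_on UNIV (\<lambda>v. xi (s + h v) * exp ((J - (s + h v))\<^sup>2 / of_real T))"
      unfolding h_def using T
      by (intro continuous_intros continuous_on_compose2[OF xi_continuous[of UNIV]]) auto
    then have "(\<lambda>v. xi (s + h v) * exp ((J - (s + h v))\<^sup>2 / of_real T)) \<in> borel_measurable lborel"
      by (simp add: borel_measurable_continuous_onI)
    then have "(\<lambda>v. 1 / G * (G * (R v * f v)) - f v) \<in> borel_measurable lborel"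
      unfolding key using borel_measurable_integrable[OF fint] by measurable
    moreover have "(\<lambda>v. 1 / G * (G * (R v * f v)) - f v) = g"
      using G0 by (simp add: g_def algebra_simps)
    ultimately show ?thesis by simp
  qed
  have bound: "norm (g v) \<le> B * exp (- (v\<^sup>2 / (2 * T)))" for v
  proof -
    have "norm (R v - 1) \<le> exp (\<epsilon> * (1 + (d\<^sup>2 + v\<^sup>2))) - 1"
      unfolding R_def using shift[OF h(1)[of v] h(2)[of v]] by (simp only: h(3))
    also have "\<dots> \<le> \<epsilon> * ((1 + 4 * C) * exp (1 / (4 * C))) * exp ((d\<^sup>2 + v\<^sup>2) / (2 * T))"
      by (intro exp_minus_one_le_gaussian C T eps) simp
    finally have R: "norm (R v - 1) \<le> \<epsilon> * ((1 + 4 * C) * exp (1 / (4 * C))) * exp ((d\<^sup>2 + v\<^sup>2) / (2 * T))" .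
    have f: "norm (f v) \<le> M * (exp (d\<^sup>2 / T) * exp (- (v\<^sup>2 / T)))"
      unfolding f_def norm_mult h_def norm_exp_gaussian
      by (intro mult_right_mono M) (use h(2)[of v] in \<open>auto simp: h_def\<close>)
    have "norm (g v) \<le> \<epsilon> * ((1 + 4 * C) * exp (1 / (4 * C))) * exp ((d\<^sup>2 + v\<^sup>2) / (2 * T)) * (M * (exp (d\<^sup>2 / T) * exp (- (v\<^sup>2 / T))))"
      unfolding g_def norm_mult using eps(1) C by (intro mult_mono R f mult_nonneg_nonneg) auto
    also have "\<dots> = \<epsilon> * ((1 + 4 * C) * exp (1 / (4 * C))) * M * exp ((d\<^sup>2 + v\<^sup>2) / (2 * T) + d\<^sup>2 / T - v\<^sup>2 / T)"
    proof -
      have "exp ((d\<^sup>2 + v\<^sup>2) / (2 * T) + d\<^sup>2 / T - v\<^sup>2 / T) = exp ((d\<^sup>2 + v\<^sup>2) / (2 * T)) * (exp (d\<^sup>2 / T) * exp (- (v\<^sup>2 / T)))"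
        unfolding exp_add [symmetric] by simp
      then show ?thesis by (simp only: mult_ac)
    qed
    also have "(d\<^sup>2 + v\<^sup>2) / (2 * T) + d\<^sup>2 / T - v\<^sup>2 / T = 3 / 2 * d\<^sup>2 / T + - (v\<^sup>2 / (2 * T))"
      using T by (simp add: field_simps)
    finally show ?thesis unfolding B_def exp_add by (simp only: mult_ac)
  qed
  have Eint: "integrable lborel (\<lambda>v. B * exp (- (v\<^sup>2 / (2 * T))))"
    using T by (intro integrable_mult_right real_gaussian) auto
  have gint: "integrable lborel g"
    by (rule Bochner_Integration.integrable_bound[OF Eint gm])
       (intro AE_I2 order_trans[OF bound], simp add: abs_ge_self)
  have "norm (LINT v|lborel. g v) \<le> (LINT v|lborel. B * exp (- (v\<^sup>2 / (2 * T))))"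
    by (rule order_trans[OF integral_norm_bound]) (intro integral_mono integrable_norm gint Eint bound)
  also have "\<dots> = B * sqrt (pi * (2 * T))"
    using T real_gaussian(2)[of "2 * T"] by simp
  also have "\<dots> = sqrt 2 * B * sqrt (pi * T)"
    by (simp add: real_sqrt_mult)
  finally have gbound: "norm (LINT v|lborel. g v) \<le> sqrt 2 * B * sqrt (pi * T)" .
  define S where "S = sqrt (pi * T)"
  have S: "0 < S" using T by (simp add: S_def)
  define E where "E = 1 / of_real S * (LINT v|lborel. g v)"
  have "norm E = norm (LINT v|lborel. g v) / S" using S by (simp add: E_def norm_mult norm_divide)
  also have "\<dots> \<le> sqrt 2 * B"
    using gbound S by (simp add: pos_divide_le_eq S_def)
  finally have "norm E \<le> sqrt 2 * B" .
  moreover have "xi_t xi t J = G * (F_t a t s + E)"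
  proof -
    define c where "c = Re s + d"
    define p where "p = (\<lambda>v. xi (of_real c + \<i> * of_real v) * exp ((J - (of_real c + \<i> * of_real v))\<^sup>2 / of_real T))"
    \<comment> \<open>Translation by Im s re-centres the vertical line at the height of s.\<close>
    have p: "p (Im s + 1 * v) = G * (R v * f v)" for v
    proof -
      have "of_real c + \<i> * of_real (Im s + 1 * v) = s + h v"
        by (simp add: complex_eq_iff c_def h_def)
      then show ?thesis unfolding p_def key [symmetric] by (simp only:)
    qed
    have "xi_t xi t J = 1 / of_real S * (LINT v|lborel. p v)"
      unfolding p_def S_def T_def by (rule xi_t_line_integral) (use t d in \<open>auto simp: c_def\<close>)
    also have "(LINT v|lborel. p v) = (LINT v|lborel. p (Im s + 1 * v))"
      using lborel_integral_real_affine[of 1 p "Im s"] by simp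
    also have "\<dots> = G * (LINT v|lborel. g v + f v)"
      unfolding p integral_mult_right_zero by (simp add: g_def algebra_simps)
    also have "(LINT v|lborel. g v + f v) = (LINT v|lborel. g v) + of_real S * F_t a t s"
      by (simp add: Bochner_Integration.integral_add[OF gint fint] fval S_def)
    also have "1 / of_real S * (G * ((LINT v|lborel. g v) + of_real S * F_t a t s)) = G * (F_t a t s + E)"
      using S by (simp add: E_def field_simps)
    finally show ?thesis .
  qed
  ultimately show ?thesis unfolding J_def G_def B_def T_def by blast
qed

end

theorem mainTheorem4:
  fixes a :: "nat \<Rightarrow> complex" and F :: "complex \<Rightarrow> complex" and m :: nat
    and \<alpha> :: complex and Q :: real and k :: nat and \<omega> :: "nat \<Rightarrow> real"
    and \<mu> :: "nat \<Rightarrow> complex" and xi :: "complex \<Rightarrow> complex" and C :: real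
  assumes "selberg_sharp a F m \<alpha> Q k \<omega> \<mu> xi"
    and "0 < C"
  shows "\<exists>y0 > 0. \<exists>K > 0. \<forall>t s.
           t < 0 \<and> \<bar>t\<bar> \<le> C \<and> 0 < Im s \<and> \<bar>Re s\<bar> \<le> C * Im s powr (1/4) \<and> y0 \<le> Im s \<longrightarrow>
           (\<exists>E. xi_t xi t (J_t Q k \<omega> t s) = gamma_t m \<alpha> Q k \<omega> \<mu> t s * (F_t a t s + E) \<and>
                norm E \<le> K * Im s powr (-1/5) * exp (10 / \<bar>t\<bar> * (min (Re s) (-2))\<^sup>2))"
proof -
  note C = \<open>0 < C\<close>
  interpret extended_selberg a F m \<alpha> Q k \<omega> \<mu> xi by unfold_locales fact
  obtain M where M: "0 < M" "\<And>w. 2 \<le> Re w \<Longrightarrow> norm (F w) \<le> M"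
    by (rule F_bounded) (rule that)
  obtain K Y where K: "0 < K" and Y: "0 < Y" and shift:
    "\<And>(s :: complex) (h :: complex). \<lbrakk>Y \<le> Im s; \<bar>Re s\<bar> \<le> Im s / 8; 0 \<le> Re h; 2 \<le> Re (s + h)\<rbrakk> \<Longrightarrow>
       gamma_fac m \<alpha> Q k \<omega> \<mu> s \<noteq> 0 \<and>
       norm (gamma_fac m \<alpha> Q k \<omega> \<mu> (s + h) / gamma_fac m \<alpha> Q k \<omega> \<mu> s * exp (- (\<Lambda> s * h)) - 1)
         \<le> exp (K * (1 + (norm h)\<^sup>2) / sqrt (Im s)) - 1"
    by (rule gamma_fac_shift) (rule that)
  define D where "D = sqrt 2 * (((1 + 4 * C) * exp (1 / (4 * C))) * M) * K"
  \<comment> \<open>(8 C)^2 <= y turns the hypothesis on Re s into |Re s| <= y / 8, and (4 C K)^2 <=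
    y gives K / sqrt y <= 1 / (4 C), the smallness that the Gaussian absorption requires.\<close>
  define y0 where "y0 = Y + 1 + (8 * C)\<^sup>2 + (4 * C * K)\<^sup>2"
  have D: "0 < D" unfolding D_def using C M(1) K by simp
  have y0: "0 < y0" unfolding y0_def using Y by (simp add: add_pos_nonneg)
  have "\<exists>E. xi_t xi t (J_t Q k \<omega> t s) = gamma_t m \<alpha> Q k \<omega> \<mu> t s * (F_t a t s + E) \<and>
                norm E \<le> D * Im s powr (-1/5) * exp (10 / \<bar>t\<bar> * (min (Re s) (-2))\<^sup>2)"
    if t: "t < 0" "\<bar>t\<bar> \<le> C" and s: "\<bar>Re s\<bar> \<le> C * Im s powr (1/4)" and y: "y0 \<le> Im s" for t s
  proof -
    define y where "y = Im s"
    have "0 \<le> (8 * C)\<^sup>2" "0 \<le> (4 * C * K)\<^sup>2" by simp_all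
    then have yY: "Y \<le> y" "1 \<le> y" "(8 * C)\<^sup>2 \<le> y" "(4 * C * K)\<^sup>2 \<le> y"
      using y Y unfolding y_def y0_def by linarith+
    have sq: "8 * C \<le> sqrt y" "4 * C * K \<le> sqrt y" "0 < sqrt y"
      using yY by (auto intro: real_le_rsqrt)
    have "\<bar>Re s\<bar> \<le> y / 8"
    proof -
      have "y powr (1/4) \<le> y powr (1/2)" using yY by (intro powr_mono) auto
      then have "C * y powr (1/4) \<le> C * sqrt y" using C yY by (intro mult_left_mono) (auto simp: powr_half_sqrt)
      also have "\<dots> \<le> sqrt y / 8 * sqrt y" using sq by (intro mult_right_mono) auto
      also have "\<dots> = y / 8" using yY by simp
      finally show ?thesis using s by (simp add: y_def)
    qed
    note shift' = shift[OF yY(1)[unfolded y_def] this[unfolded y_def]]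
    have gs: "gamma_fac m \<alpha> Q k \<omega> \<mu> s \<noteq> 0"
      \<comment> \<open>Any admissible h serves here; |Re s| + 2 satisfies both side
        conditions.\<close>
      using shift'[of "of_real (\<bar>Re s\<bar> + 2)"] by auto
    have eps: "0 \<le> K / sqrt (Im s)" "K / sqrt (Im s) \<le> 1 / (4 * C)"
      using K C sq unfolding y_def by (auto simp: field_simps)
    have shiftE: "norm (gamma_fac m \<alpha> Q k \<omega> \<mu> (s + h) / gamma_fac m \<alpha> Q k \<omega> \<mu> s * exp (- (\<Lambda> s * h)) - 1)
         \<le> exp (K / sqrt (Im s) * (1 + (norm h)\<^sup>2)) - 1" if "0 \<le> Re h" "2 \<le> Re (s + h)" for h
      using shift'[OF that] by (simp only: times_divide_eq_left)
    define d where "d = max (Re s) 2 - Re s"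
    have "\<exists>E. xi_t xi t (J_t Q k \<omega> t s) = gamma_t m \<alpha> Q k \<omega> \<mu> t s * (F_t a t s + E) \<and>
        norm E \<le> sqrt 2 * (K / sqrt y * ((1 + 4 * C) * exp (1 / (4 * C))) * M * exp (3 / 2 * d\<^sup>2 / \<bar>t\<bar>))"
      unfolding y_def d_def by (rule xi_t_error[OF t C M eps gs shiftE])
    then obtain E where E: "xi_t xi t (J_t Q k \<omega> t s) = gamma_t m \<alpha> Q k \<omega> \<mu> t s * (F_t a t s + E)"
      and nE: "norm E \<le> sqrt 2 * (K / sqrt y * ((1 + 4 * C) * exp (1 / (4 * C))) * M * exp (3 / 2 * d\<^sup>2 / \<bar>t\<bar>))"
      by blast
    \<comment> \<open>The rate y^(-1/2) actually obtained is weakened to the stated one, using y >=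
      1.\<close>
    have "1 / sqrt y \<le> y powr (-1/5)"
    proof -
      have "1 / sqrt y = y powr (- (1 / 2))"
        using yY by (simp only: powr_minus_divide powr_half_sqrt)
      also have "\<dots> \<le> y powr (-1/5)" using yY by (intro powr_mono) auto
      finally show ?thesis .
    qed
    moreover have "exp (3 / 2 * d\<^sup>2 / \<bar>t\<bar>) \<le> exp (10 / \<bar>t\<bar> * (min (Re s) (-2))\<^sup>2)"
      using divide_right_mono[OF max_gap_square_le[of "Re s"], of "\<bar>t\<bar>"] by (simp add: d_def)
    ultimately have "D * (1 / sqrt y) * exp (3 / 2 * d\<^sup>2 / \<bar>t\<bar>) \<le> D * y powr (-1/5) * exp (10 / \<bar>t\<bar> * (min (Re s) (-2))\<^sup>2)"
      using D by (intro mult_mono mult_left_mono) auto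
    moreover have "sqrt 2 * (K / sqrt y * ((1 + 4 * C) * exp (1 / (4 * C))) * M * exp (3 / 2 * d\<^sup>2 / \<bar>t\<bar>)) = D * (1 / sqrt y) * exp (3 / 2 * d\<^sup>2 / \<bar>t\<bar>)"
      by (simp add: D_def mult_ac)
    ultimately have "norm E \<le> D * Im s powr (-1/5) * exp (10 / \<bar>t\<bar> * (min (Re s) (-2))\<^sup>2)"
      using nE unfolding y_def by linarith
    with E show ?thesis by blast
  qed
  then show ?thesis using y0 D by blast
qed

end
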